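(* Let $2\le k\le N$ be integers, write $\mathbb{R}^N=\mathbb{R}^k\times\mathbb{R}^{N-k}$ and $x=(x',z)\in\mathbb{R}^k\times\mathbb{R}^{N-k}$. Let $q,s$ be real numbers with $1<q<N$, $0\le s\le q$ and $s<k$, and let $q_*\in\big[q,\frac{q(N-s)}{N-q}\big]$. Then there exists a positive constant $C=C(s,q,N,k)$ such that for all $f\in C_0^\infty(\mathbb{R}^N)$, $$\Big(\int_{\mathbb{R}^N}\frac{|f|^{q_*}}{|x'|^s}\,dx\Big)^{\frac{1}{q_*}}\le C\,\|f\|_q^{\frac{N-s}{q_*}-\frac Nq+1}\,\|\nabla f\|_q^{\frac Nq-\frac{N-s}{q_*}}.$$ In particular, if $N=3$, $k=2$, $q=2$, $0\le s<2$, $q_*\in[2,2(3-s)]$ and $r=\sqrt{x_1^2+x_2^2}$, then there exists a positive constant $C(s)$ such that for all $f\in C_0^\infty(\mathbb{R}^3)$, $$\Big\|\frac{f}{r^{s/q_*}}\Big\|_{q_*}\le C(s)\,\|f\|_2^{\frac{3-s}{q_*}-\frac12}\,\|\nabla f\|_2^{\frac32-\frac{3-s}{q_*}}.$$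
   Context: $\|\cdot\|_q$ denotes the $L^q$ norm over the whole space ($\mathbb{R}^N$, respectively $\mathbb{R}^3$). *)

theory Defs
  imports "HOL-Analysis.Analysis"
begin

fun C_k :: "nat \<Rightarrow> (real ^ 'n \<Rightarrow> real) \<Rightarrow> bool" where
  "C_k 0 f \<longleftrightarrow> continuous_on UNIV f"
| "C_k (Suc m) f \<longleftrightarrow>
     (\<forall>x. f differentiable (at x)) \<and>
     (\<forall>i. C_k m (\<lambda>x. frechet_derivative f (at x) (axis i 1)))"

definition C0_infinity :: "(real ^ 'n \<Rightarrow> real) set" where
  "C0_infinity = {f. (\<forall>m. C_k m f) \<and> compact (closure {x. f x \<noteq> 0})}"

definition grad :: "(real ^ 'n \<Rightarrow> real) \<Rightarrow> real ^ 'n \<Rightarrow> real ^ 'n" where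
  "grad f x = (\<chi> i. frechet_derivative f (at x) (axis i 1))"

text \<open>The Bochner integral of a non-integrable function is 0, so this is the \<open>L\<close>-norm with
  exponent \<open>p\<close> only for functions whose \<open>p\<close>-th power is integrable. This is automatic for
  \<open>f \<in> C0_infinity\<close> and for its gradient; elsewhere integrability has to be stated separately.\<close>

definition Lnorm :: "real \<Rightarrow> (real ^ 'n \<Rightarrow> 'b::real_normed_vector) \<Rightarrow> real" where
  "Lnorm p f = (LINT x|lborel. norm (f x) powr p) powr (1 / p)"

text \<open>A splitting of the space into a \<open>k\<close>-dimensional and a complementary coordinate space is
  given by the set \<open>K\<close> (of cardinality \<open>k\<close>) of the coordinates forming the first component \<open>x'\<close>,
  which also covers the case of a zero-dimensional complement. The following is the Euclidean
  norm of \<open>x'\<close>. Divisions by its powers are 0 by convention where \<open>x' = 0\<close>, also for the exponent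
  0 (as \<open>0 powr 0 = 0\<close>); for nonempty \<open>K\<close> this concerns a null set only.\<close>

definition norm_on :: "'n set \<Rightarrow> real ^ 'n \<Rightarrow> real" where
  "norm_on K x = sqrt (\<Sum>i\<in>K. (x $ i)\<^sup>2)"

end

theory Submission
  imports Defs
begin

text \<open>Let \<open>X\<close> be the integral of \<open>|f|^p / |x'|^s\<close>. Testing \<open>|f|^p\<close> against the divergence of the field
  \<open>x' / |x'|^s\<close> gives \<open>(k - s) X \<le> p \<integral> |f|^(p - 1) |grad f| |x'|^(1 - s)\<close>, and for \<open>1 \<le> s \<le> q\<close> Hoelder's inequality bounds the
  right-hand side by \<open>X^(1 - 1 / s)\<close>, the \<open>L^q\<close> norm of the gradient and the unweighted integral of \<open>|f|^p0\<close>, where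
  \<open>p = (1 - s / q) p0 + s\<close>. For \<open>s < 1\<close> one interpolates between \<open>s = 1\<close> (available as \<open>k \<ge> 2\<close>) and \<open>s = 0\<close>. The
  exponent \<open>p0\<close> ranges between \<open>q\<close> and the Sobolev exponent \<open>q N / (N - q)\<close>, so the unweighted integral is controlled by
  the Sobolev inequality, which follows from Gagliardo's argument with the Loomis-Whitney inequality. Replacing \<open>|x'|^2\<close>
  by \<open>e + |x'|^2\<close> makes all integrals finite; Fatou's lemma gives the limit \<open>e \<rightarrow> 0\<close> together with integrability.\<close>

section \<open>Hoelder's inequality for finitely many factors\<close>

text \<open>Jensen's inequality for \<open>exp\<close> at the points \<open>ln (y i)\<close>. If
  some \<open>y i\<close> is 0, the left-hand side vanishes, since \<open>0 powr a = 0\<close> holds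
  even for \<open>a = 0\<close>.\<close>

lemma weighted_am_gm:
  fixes y a :: "'i \<Rightarrow> real"
  assumes I: "finite I" and a: "\<And>i. i \<in> I \<Longrightarrow> 0 \<le> a i" "(\<Sum>i\<in>I. a i) = 1"
    and y: "\<And>i. i \<in> I \<Longrightarrow> 0 \<le> y i"
  shows "(\<Prod>i\<in>I. y i powr a i) \<le> (\<Sum>i\<in>I. a i * y i)"
proof (cases "\<exists>i\<in>I. y i = 0")
  case True
  then have "(\<Prod>i\<in>I. y i powr a i) = 0"
    using I by (auto simp: prod_zero_iff)
  also have "0 \<le> (\<Sum>i\<in>I. a i * y i)"
    by (intro sum_nonneg mult_nonneg_nonneg a y)
  finally show ?thesis .
next
  case False
  then have pos: "y i > 0" if "i \<in> I" for i
    using y[OF that] that by force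
  have "I \<noteq> {}" using a(2) by auto
  have "(\<Prod>i\<in>I. y i powr a i) = (\<Prod>i\<in>I. exp (a i * ln (y i)))"
    using pos by (intro prod.cong) (auto simp: powr_def less_imp_neq[THEN not_sym])
  also have "\<dots> = exp (\<Sum>i\<in>I. a i *\<^sub>R ln (y i))"
    using I by (simp add: exp_sum)
  also have "\<dots> \<le> (\<Sum>i\<in>I. a i * exp (ln (y i)))"
    by (rule convex_on_sum[OF I \<open>I \<noteq> {}\<close> exp_convex]) (use a in auto)
  also have "\<dots> = (\<Sum>i\<in>I. a i * y i)"
    using pos by (intro sum.cong) auto
  finally show ?thesis .
qed

text \<open>Dividing each factor by its bound \<open>A i\<close> and applying the weighted AM-GM
  inequality pointwise leaves a convex combination with integral at most 1. If
  \<open>A i = 0\<close>, the factor \<open>F i\<close>, and with it the product, vanishes almost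
  everywhere. Stating it with upper bounds \<open>A i\<close> avoids any integrability question for
  the product.\<close>

lemma nn_integral_Holder_prod:
  fixes F :: "'i \<Rightarrow> 'a \<Rightarrow> real"
  assumes I: "finite I" and a: "\<And>i. i \<in> I \<Longrightarrow> 0 \<le> a i" "(\<Sum>i\<in>I. a i) = 1"
    and F[measurable]: "\<And>i. i \<in> I \<Longrightarrow> F i \<in> borel_measurable M"
    and F0: "\<And>i x. i \<in> I \<Longrightarrow> 0 \<le> F i x"
    and A: "\<And>i. i \<in> I \<Longrightarrow> 0 \<le> A i" "\<And>i. i \<in> I \<Longrightarrow> (\<integral>\<^sup>+x. ennreal (F i x) \<partial>M) \<le> ennreal (A i)"
  shows "(\<integral>\<^sup>+x. ennreal (\<Prod>i\<in>I. F i x powr a i) \<partial>M) \<le> ennreal (\<Prod>i\<in>I. A i powr a i)"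
proof (cases "\<exists>i\<in>I. A i = 0")
  case True
  then obtain i where i: "i \<in> I" "A i = 0" by blast
  then have "(\<integral>\<^sup>+x. ennreal (F i x) \<partial>M) = 0"
    using A(2)[OF i(1)] by simp
  then have "AE x in M. ennreal (F i x) = 0"
    using i by (subst (asm) nn_integral_0_iff_AE) auto
  then have "AE x in M. ennreal (\<Prod>i\<in>I. F i x powr a i) = 0"
  proof eventually_elim
    case (elim x)
    then have "F i x = 0" using F0[OF i(1), of x] by simp
    then have "(\<Prod>i\<in>I. F i x powr a i) = 0"
      using i I by (auto simp: prod_zero_iff)
    then show ?case by simp
  qed
  then have "(\<integral>\<^sup>+x. ennreal (\<Prod>i\<in>I. F i x powr a i) \<partial>M) = (\<integral>\<^sup>+x. 0 \<partial>M)"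
    by (rule nn_integral_cong_AE)
  then show ?thesis by simp
next
  case False
  then have pos: "A i > 0" if "i \<in> I" for i
    using A(1)[OF that] that by force
  let ?P = "\<Prod>i\<in>I. A i powr a i"
  have P0: "0 \<le> ?P" by (intro prod_nonneg) auto
  have "(\<integral>\<^sup>+x. ennreal (\<Prod>i\<in>I. F i x powr a i) \<partial>M)
      \<le> (\<integral>\<^sup>+x. ennreal ?P * (\<Sum>i\<in>I. ennreal (a i / A i) * ennreal (F i x)) \<partial>M)"
  proof (rule nn_integral_mono)
    fix x
    have "(\<Prod>i\<in>I. F i x powr a i) = (\<Prod>i\<in>I. A i powr a i * (F i x / A i) powr a i)"
      using pos F0 by (intro prod.cong refl) (simp add: powr_divide less_imp_le less_imp_neq[THEN not_sym])
    also have "\<dots> = ?P * (\<Prod>i\<in>I. (F i x / A i) powr a i)"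
      by (rule prod.distrib)
    also have "\<dots> \<le> ?P * (\<Sum>i\<in>I. a i * (F i x / A i))"
      using F0 pos by (intro mult_left_mono P0 weighted_am_gm I a) (auto simp: less_imp_le)
    also have "ennreal \<dots> = ennreal ?P * (\<Sum>i\<in>I. ennreal (a i / A i) * ennreal (F i x))"
      using F0 pos a P0
      by (subst ennreal_mult, auto intro!: sum_nonneg simp: less_imp_le)
         (subst sum_ennreal[symmetric], auto simp: ennreal_mult[symmetric] less_imp_le)
    finally show "ennreal (\<Prod>i\<in>I. F i x powr a i)
        \<le> ennreal ?P * (\<Sum>i\<in>I. ennreal (a i / A i) * ennreal (F i x))"
      by (simp add: ennreal_leI)
  qed
  also have "\<dots> = ennreal ?P * (\<Sum>i\<in>I. ennreal (a i / A i) * (\<integral>\<^sup>+x. ennreal (F i x) \<partial>M))"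
    by (simp add: nn_integral_cmult nn_integral_sum)
  also have "\<dots> \<le> ennreal ?P * (\<Sum>i\<in>I. ennreal (a i / A i) * ennreal (A i))"
    by (intro mult_left_mono sum_mono A) auto
  also have "(\<Sum>i\<in>I. ennreal (a i / A i) * ennreal (A i)) = (\<Sum>i\<in>I. ennreal (a i))"
    using pos a by (intro sum.cong refl, subst ennreal_mult[symmetric]) (auto simp: less_imp_le less_imp_neq[THEN not_sym])
  also have "\<dots> = 1"
    using a by (simp add: sum_ennreal)
  finally show ?thesis by simp
qed

section \<open>Partial integrals and the Loomis-Whitney inequality\<close>

definition override :: "'i set \<Rightarrow> ('i \<Rightarrow> 'b) \<Rightarrow> ('i \<Rightarrow> 'b) \<Rightarrow> 'i \<Rightarrow> 'b" where
  "override A y x = (\<lambda>i. if i \<in> A then y i else x i)"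

text \<open>The variables in \<open>A\<close> are integrated out, but the result is still a function
  of a full point \<open>x\<close>, constant in the coordinates from \<open>A\<close>. Partial
  integrals over different sets thus have the same type and measure space, which suits induction on
  \<open>A\<close>.\<close>

definition part_int :: "'i set \<Rightarrow> (('i \<Rightarrow> real) \<Rightarrow> ennreal) \<Rightarrow> ('i \<Rightarrow> real) \<Rightarrow> ennreal" where
  "part_int A h x = (\<integral>\<^sup>+y. h (override A y x) \<partial>PiM A (\<lambda>_. lborel))"

interpretation lborel_PiM: product_sigma_finite "\<lambda>_. lborel :: real measure" ..

lemma measurable_override:
  assumes "A \<subseteq> I"
  shows "(\<lambda>z. override A (snd z) (fst z)) \<in>
    PiM I (\<lambda>_. lborel :: real measure) \<Otimes>\<^sub>M PiM A (\<lambda>_. lborel) \<rightarrow>\<^sub>M PiM I (\<lambda>_. lborel)"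
  unfolding override_def
proof (rule measurable_PiM_single')
  fix i assume "i \<in> I"
  show "(\<lambda>z. if i \<in> A then snd z i else fst z i) \<in>
      PiM I (\<lambda>_. lborel :: real measure) \<Otimes>\<^sub>M PiM A (\<lambda>_. lborel) \<rightarrow>\<^sub>M lborel"
    using \<open>i \<in> I\<close> by (cases "i \<in> A") auto
next
  show "(\<lambda>\<omega> i. if i \<in> A then snd \<omega> i else fst \<omega> i)
    \<in> space (Pi\<^sub>M I (\<lambda>_. lborel :: real measure) \<Otimes>\<^sub>M Pi\<^sub>M A (\<lambda>_. lborel)) \<rightarrow> I \<rightarrow>\<^sub>E space lborel"
    using assms by (auto simp: space_pair_measure space_PiM PiE_iff extensional_def)
qed

lemma measurable_part_int:
  assumes "finite A" "A \<subseteq> I" and [measurable]: "h \<in> borel_measurable (PiM I (\<lambda>_. lborel))"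
  shows "part_int A h \<in> borel_measurable (PiM I (\<lambda>_. lborel))"
proof -
  interpret finite_product_sigma_finite "\<lambda>_. lborel :: real measure" A
    by standard fact
  note [measurable] = measurable_override[OF assms(2)]
  show ?thesis
    unfolding part_int_def by measurable
qed

text \<open>Tonelli's theorem with the new variable outermost; it is the induction step for all
  estimates of partial integrals.\<close>

lemma part_int_insert:
  assumes "finite A" "a \<notin> A" "insert a A \<subseteq> I"
    and h: "h \<in> borel_measurable (PiM I (\<lambda>_. lborel))" and x: "x \<in> space (PiM I (\<lambda>_. lborel))"
  shows "part_int (insert a A) h x = (\<integral>\<^sup>+t. part_int A h (x(a := t)) \<partial>lborel)"
proof -
  have "(\<lambda>y. (x, y)) \<in> PiM (insert a A) (\<lambda>_. lborel) \<rightarrow>\<^sub>M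
      PiM I (\<lambda>_. lborel :: real measure) \<Otimes>\<^sub>M PiM (insert a A) (\<lambda>_. lborel)"
    using x by measurable
  from measurable_compose[OF measurable_compose[OF this measurable_override[OF assms(3)]] h]
  have "(\<lambda>y. h (override (insert a A) y x)) \<in> borel_measurable (PiM (insert a A) (\<lambda>_. lborel))"
    by simp
  from lborel_PiM.product_nn_integral_insert_rev[OF assms(1,2) this]
  have "part_int (insert a A) h x =
     (\<integral>\<^sup>+t. \<integral>\<^sup>+y. h (override (insert a A) (y(a := t)) x) \<partial>PiM A (\<lambda>_. lborel) \<partial>lborel)"
    by (simp add: part_int_def)
  moreover have "override (insert a A) (y(a := t)) x = override A y (x(a := t))" for y t
    using assms(2) by (auto simp: override_def)
  ultimately show ?thesis
    by (simp add: part_int_def)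
qed

lemma part_int_upd: "a \<in> A \<Longrightarrow> part_int A h (x(a := t)) = part_int A h x"
  by (auto simp: part_int_def override_def intro!: nn_integral_cong arg_cong[where f=h])

text \<open>Integrating one more variable \<open>a\<close>, the factor with index \<open>a\<close> does not depend on it, so that
  Hoelder's inequality for the remaining \<open>card I - 1\<close> factors applies.\<close>

lemma Loomis_Whitney:
  fixes h :: "'i \<Rightarrow> ('i \<Rightarrow> real) \<Rightarrow> ennreal"
  assumes I: "finite I" "card I \<ge> 2" and p: "p = 1 / (real (card I) - 1)"
    and h: "\<And>i. i \<in> I \<Longrightarrow> h i \<in> borel_measurable (PiM I (\<lambda>_. lborel))"
    and fin: "\<And>i A x. i \<in> I \<Longrightarrow> A \<subseteq> I \<Longrightarrow> part_int A (h i) x < \<infinity>"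
    and x: "x \<in> space (PiM I (\<lambda>_. lborel))" and A: "A \<subseteq> I"
  shows "part_int A (\<lambda>x. ennreal (\<Prod>i\<in>I. enn2real (part_int {i} (h i) x) powr p)) x
    \<le> ennreal (\<Prod>i\<in>I. enn2real (part_int (insert i A) (h i) x) powr p)"
  using finite_subset[OF A I(1)] A x
proof (induction A arbitrary: x rule: finite_induct)
  case empty
  have "override {} y x = x" for y by (auto simp: override_def)
  then show ?case
    by (simp add: part_int_def[of "{}"] PiM_empty nn_integral_count_space_finite)
next
  case (insert a A)
  let ?L = "\<lambda>x. ennreal (\<Prod>i\<in>I. enn2real (part_int {i} (h i) x) powr p)"
  let ?c = "\<lambda>i x. enn2real (part_int (insert i A) (h i) x)"
  have aI: "a \<in> I" and AI: "A \<subseteq> I" using insert by auto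
  have mx: "(\<lambda>t. x(a := t)) \<in> lborel \<rightarrow>\<^sub>M PiM I (\<lambda>_. lborel)"
    by (rule measurable_fun_upd[where J=I]) (use aI insert.prems in auto)
  have xt: "x(a := t) \<in> space (PiM I (\<lambda>_. lborel))" for t
    using insert.prems aI by (auto simp: space_PiM PiE_iff extensional_def)
  have [measurable]: "part_int {i} (h i) \<in> borel_measurable (PiM I (\<lambda>_. lborel))" if "i \<in> I" for i
    using that by (intro measurable_part_int h) auto
  have [measurable]: "?L \<in> borel_measurable (PiM I (\<lambda>_. lborel))"
    by measurable
  have m[measurable]: "part_int (insert i A) (h i) \<in> borel_measurable (PiM I (\<lambda>_. lborel))" if "i \<in> I" for i
    using that insert by (intro measurable_part_int h) auto
  have *: "(\<integral>\<^sup>+t. ennreal (\<Prod>i\<in>I - {a}. ?c i (x(a := t)) powr p) \<partial>lborel)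
     \<le> ennreal (\<Prod>i\<in>I - {a}. enn2real (part_int (insert i (insert a A)) (h i) x) powr p)"
  proof (rule nn_integral_Holder_prod)
    show "(\<Sum>i\<in>I - {a}. p) = 1"
      using I aI by (simp add: p of_nat_diff)
    show "p \<ge> 0" using I p by auto
    show "(\<lambda>t. ?c i (x(a := t))) \<in> borel_measurable lborel" if "i \<in> I - {a}" for i
      using that by (intro measurable_compose[OF measurable_compose[OF mx m] borel_measurable_enn2real]) auto
    fix i assume i: "i \<in> I - {a}"
    \<comment> \<open>As \<open>enn2real\<close> sends infinity to 0, the finiteness assumption
      \<open>fin\<close> is what makes the passage to real numbers lossless.\<close>
    have "(\<integral>\<^sup>+t. ennreal (?c i (x(a := t))) \<partial>lborel)
        = (\<integral>\<^sup>+t. part_int (insert i A) (h i) (x(a := t)) \<partial>lborel)"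
      using fin[of i "insert i A"] i AI by (intro nn_integral_cong) (auto simp: less_top)
    also have "\<dots> = part_int (insert a (insert i A)) (h i) x"
      using i aI AI insert.hyps insert.prems
      by (intro part_int_insert[symmetric, where I=I] h) auto
    also have "insert a (insert i A) = insert i (insert a A)" by auto
    also have "part_int (insert i (insert a A)) (h i) x
        = ennreal (enn2real (part_int (insert i (insert a A)) (h i) x))"
      using fin[of i "insert i (insert a A)" x] i AI aI by (auto simp: less_top)
    finally show "(\<integral>\<^sup>+t. ennreal (?c i (x(a := t))) \<partial>lborel)
      \<le> ennreal (enn2real (part_int (insert i (insert a A)) (h i) x))"
      by (rule eq_refl)
  qed (use I in auto)
  have "part_int (insert a A) ?L x = (\<integral>\<^sup>+t. part_int A ?L (x(a := t)) \<partial>lborel)"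
    using insert by (intro part_int_insert[where I=I]) auto
  also have "\<dots> \<le> (\<integral>\<^sup>+t. ennreal (\<Prod>i\<in>I. ?c i (x(a := t)) powr p) \<partial>lborel)"
    by (intro nn_integral_mono insert.IH AI xt)
  also have "\<dots> = (\<integral>\<^sup>+t. ennreal (?c a x powr p) * ennreal (\<Prod>i\<in>I - {a}. ?c i (x(a := t)) powr p) \<partial>lborel)"
  proof (rule nn_integral_cong)
    fix t
    have "(\<Prod>i\<in>I. ?c i (x(a := t)) powr p) = ?c a (x(a := t)) powr p * (\<Prod>i\<in>I - {a}. ?c i (x(a := t)) powr p)"
      by (rule prod.remove[OF I(1) aI])
    then show "ennreal (\<Prod>i\<in>I. ?c i (x(a := t)) powr p)
        = ennreal (?c a x powr p) * ennreal (\<Prod>i\<in>I - {a}. ?c i (x(a := t)) powr p)"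
      by (simp add: part_int_upd ennreal_mult prod_nonneg)
  qed
  also have "\<dots> = ennreal (?c a x powr p) * (\<integral>\<^sup>+t. ennreal (\<Prod>i\<in>I - {a}. ?c i (x(a := t)) powr p) \<partial>lborel)"
    by (intro nn_integral_cmult measurable_compose[OF _ measurable_ennreal] borel_measurable_prod
        powr_real_measurable borel_measurable_const
        measurable_compose[OF measurable_compose[OF mx m] borel_measurable_enn2real]) auto
  also have "\<dots> \<le> ennreal (?c a x powr p) *
      ennreal (\<Prod>i\<in>I - {a}. enn2real (part_int (insert i (insert a A)) (h i) x) powr p)"
    by (intro mult_left_mono *) auto
  also have "\<dots> = ennreal (\<Prod>i\<in>I. enn2real (part_int (insert i (insert a A)) (h i) x) powr p)"
    by (subst prod.remove[OF I(1) aI]) (simp add: ennreal_mult prod_nonneg)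
  finally show ?case .
qed


section \<open>Hoelder's inequality for Bochner integrals\<close>

lemma Holder_prod:
  fixes F :: "'i \<Rightarrow> 'a \<Rightarrow> real"
  assumes I: "finite I" and a: "\<And>i. i \<in> I \<Longrightarrow> 0 \<le> a i" "(\<Sum>i\<in>I. a i) = 1"
    and F: "\<And>i. i \<in> I \<Longrightarrow> integrable M (F i)" and F0: "\<And>i x. i \<in> I \<Longrightarrow> 0 \<le> F i x"
  shows "(LINT x|M. (\<Prod>i\<in>I. F i x powr a i)) \<le> (\<Prod>i\<in>I. (LINT x|M. F i x) powr a i)"
proof -
  have m: "\<And>i. i \<in> I \<Longrightarrow> F i \<in> borel_measurable M" using F by auto
  have "(\<integral>\<^sup>+x. ennreal (\<Prod>i\<in>I. F i x powr a i) \<partial>M) \<le> ennreal (\<Prod>i\<in>I. (LINT x|M. F i x) powr a i)"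
    by (rule nn_integral_Holder_prod[OF I a m F0])
       (auto simp: nn_integral_eq_integral F F0 intro!: Bochner_Integration.integral_nonneg)
  then show ?thesis
    using m by (intro integral_real_bounded) (auto intro: prod_nonneg)
qed

lemma Holder2:
  fixes u v :: "'a \<Rightarrow> real"
  assumes "0 \<le> a" "0 \<le> b" "a + b = 1" "integrable M u" "integrable M v"
    and "\<And>x. 0 \<le> u x" "\<And>x. 0 \<le> v x"
  shows "(LINT x|M. u x powr a * v x powr b) \<le> (LINT x|M. u x) powr a * (LINT x|M. v x) powr b"
  using Holder_prod[of "{0, 1::nat}" "\<lambda>i. if i = 0 then a else b" M "\<lambda>i. if i = 0 then u else v"] assms
  by simp

lemma Holder3:
  fixes u v w :: "'a \<Rightarrow> real"
  assumes "0 \<le> a" "0 \<le> b" "0 \<le> c" "a + b + c = 1" "integrable M u" "integrable M v" "integrable M w"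
    and "\<And>x. 0 \<le> u x" "\<And>x. 0 \<le> v x" "\<And>x. 0 \<le> w x"
  shows "(LINT x|M. u x powr a * v x powr b * w x powr c)
    \<le> (LINT x|M. u x) powr a * (LINT x|M. v x) powr b * (LINT x|M. w x) powr c"
  using Holder_prod[of "{0, 1, 2::nat}" "\<lambda>i. if i = 0 then a else if i = 1 then b else c" M
      "\<lambda>i. if i = 0 then u else if i = 1 then v else w"] assms
  by (simp add: mult.assoc add.assoc)

section \<open>Powers of absolute values and functions of bounded support\<close>

text \<open>The assumption \<open>p > 1\<close> enters at 0, where the difference quotient has
  absolute value \<open>\<bar>h\<bar> powr (p - 1)\<close> and so tends to 0. Away from 0 the
  function agrees locally with \<open>y powr p\<close> or \<open>(- y) powr p\<close>.\<close>

lemma has_real_derivative_abs_powr: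
  fixes p y :: real
  assumes p: "p > 1"
  shows "((\<lambda>y. \<bar>y\<bar> powr p) has_real_derivative p * (\<bar>y\<bar> powr (p - 1) * sgn y)) (at y)"
proof (cases y "0 :: real" rule: linorder_cases)
  case greater
  have "((\<lambda>y. y powr p) has_real_derivative p * (\<bar>y\<bar> powr (p - 1) * sgn y)) (at y)"
    using greater by (auto intro!: derivative_eq_intros)
  then show ?thesis
    by (rule DERIV_cong_ev[THEN iffD1, rotated -1])
       (use greater in \<open>auto intro!: eventually_mono[OF eventually_gt_at_top] eventually_nhds_in_open[of "{0<..}", THEN eventually_mono]\<close>)
next
  case less
  have "((\<lambda>y. (- y) powr p) has_real_derivative p * (\<bar>y\<bar> powr (p - 1) * sgn y)) (at y)"
    using less by (auto intro!: derivative_eq_intros)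
  then show ?thesis
    by (rule DERIV_cong_ev[THEN iffD1, rotated -1])
       (use less in \<open>auto intro!: eventually_nhds_in_open[of "{..<0}", THEN eventually_mono]\<close>)
next
  case equal
  have "((\<lambda>h::real. \<bar>h\<bar> powr (p - 1)) \<longlongrightarrow> \<bar>0\<bar> powr (p - 1)) (at 0)"
    using p by (intro tendsto_powr' tendsto_intros) auto
  then have "((\<lambda>h::real. \<bar>h\<bar> powr (p - 1)) \<longlongrightarrow> 0) (at 0)"
    using p by simp
  moreover have "\<forall>\<^sub>F h::real in at 0. norm (\<bar>h\<bar> powr p / h) \<le> \<bar>h\<bar> powr (p - 1)"
    by (simp add: powr_diff)
  ultimately have "((\<lambda>h::real. \<bar>h\<bar> powr p / h) \<longlongrightarrow> 0) (at 0)"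
    by (rule Lim_null_comparison[rotated])
  then show ?thesis
    using equal by (simp add: DERIV_def)
qed

text \<open>The power damps the jump of \<open>sgn\<close> at 0. With \<open>a = p - 1\<close> this
  gives continuity of the derivative of \<open>\<bar>y\<bar> powr p\<close>.\<close>

lemma continuous_signed_powr:
  fixes a :: real
  assumes "a > 0"
  shows "continuous_on UNIV (\<lambda>y::real. \<bar>y\<bar> powr a * sgn y)"
proof -
  have "isCont (\<lambda>y::real. \<bar>y\<bar> powr a * sgn y) y" for y
  proof (cases "y = 0")
    case False
    then show ?thesis
      by (auto intro!: continuous_intros)
  next
    case True
    have "((\<lambda>h::real. \<bar>h\<bar> powr a) \<longlongrightarrow> \<bar>0\<bar> powr a) (at 0)"
      using assms by (intro tendsto_powr' tendsto_intros) auto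
    then have "((\<lambda>h::real. \<bar>h\<bar> powr a * sgn h) \<longlongrightarrow> 0) (at 0)"
      using assms
      by (intro Lim_null_comparison[of "\<lambda>h::real. \<bar>h\<bar> powr a * sgn h" "\<lambda>h. \<bar>h\<bar> powr a"])
         (auto simp: abs_mult abs_sgn_eq)
    with True show ?thesis by (simp add: isCont_def)
  qed
  then show ?thesis by (simp add: continuous_on_eq_continuous_at)
qed

lemma continuous_on_abs_powr:
  fixes f :: "'a::topological_space \<Rightarrow> real"
  assumes "a > 0" "continuous_on S f"
  shows "continuous_on S (\<lambda>x. \<bar>f x\<bar> powr a)"
  using assms by (intro continuous_on_powr' continuous_intros) auto

lemma integrable_continuous_bounded_support:
  fixes u :: "'a::euclidean_space \<Rightarrow> real"
  assumes "continuous_on UNIV u" and "\<And>x. norm x > R \<Longrightarrow> u x = 0"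
  shows "integrable lborel u"
proof -
  have "integrable lborel (\<lambda>x. indicator (cball 0 R) x *\<^sub>R u x)"
    using assms(1) by (intro borel_integrable_compact) (auto intro: continuous_on_subset)
  also have "(\<lambda>x. indicator (cball 0 R) x *\<^sub>R u x) = u"
    using assms(2) by (force simp: indicator_def)
  finally show ?thesis .
qed

lemma continuous_bounded_support_bounded:
  fixes u :: "'a::euclidean_space \<Rightarrow> real"
  assumes "continuous_on UNIV u" and "\<And>x. norm x > R \<Longrightarrow> u x = 0"
  obtains M where "M \<ge> 0" "\<And>x. \<bar>u x\<bar> \<le> M"
proof -
  have "compact (u ` cball 0 R)"
    using assms(1) by (intro compact_continuous_image) (auto intro: continuous_on_subset)
  then obtain M where M: "\<And>x. x \<in> cball 0 R \<Longrightarrow> \<bar>u x\<bar> \<le> M"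
    by (force dest!: compact_imp_bounded simp: bounded_iff)
  have "\<bar>u x\<bar> \<le> max M 0" for x
    using M[of x] assms(2)[of x] by (cases "norm x > R") auto
  with that[of "max M 0"] show ?thesis by auto
qed

text \<open>This is the class of functions for which the analytic estimates are proved. The gradient
  \<open>G\<close> is given through the inner product on an arbitrary Euclidean space, so that the
  coordinates are indexed by \<open>Basis\<close>.\<close>

locale C1_bounded_support =
  fixes f :: "'a::euclidean_space \<Rightarrow> real" and G :: "'a \<Rightarrow> 'a" and R :: real
  assumes deriv: "\<And>x. (f has_derivative (\<lambda>v. G x \<bullet> v)) (at x)"
    and cont_G: "continuous_on UNIV G"
    and f_outside: "\<And>x. norm x > R \<Longrightarrow> f x = 0"
    and G_outside: "\<And>x. norm x > R \<Longrightarrow> G x = 0"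
begin

lemma cont_f: "continuous_on UNIV f"
  using has_derivative_continuous[OF deriv] by (simp add: continuous_on_eq_continuous_at)

lemma abs_powr_line_deriv:
  assumes "p > 1"
  shows "((\<lambda>t. \<bar>f (x + t *\<^sub>R e)\<bar> powr p) has_real_derivative
    p * (\<bar>f (x + t *\<^sub>R e)\<bar> powr (p - 1) * sgn (f (x + t *\<^sub>R e))) * (G (x + t *\<^sub>R e) \<bullet> e)) (at t)"
proof -
  have "((\<lambda>t. f (x + t *\<^sub>R e)) has_derivative (\<lambda>h. G (x + t *\<^sub>R e) \<bullet> (h *\<^sub>R e))) (at t)"
    by (rule has_derivative_compose[OF _ deriv]) (auto intro!: derivative_eq_intros)
  then have "((\<lambda>t. f (x + t *\<^sub>R e)) has_real_derivative G (x + t *\<^sub>R e) \<bullet> e) (at t)"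
    by (rule has_derivative_imp_has_field_derivative) simp
  from DERIV_chain2[OF has_real_derivative_abs_powr[OF assms] this] show ?thesis
    by simp
qed

text \<open>The fundamental theorem of calculus on the line through \<open>x\<close> in direction
  \<open>b\<close>, parametrised by the \<open>b\<close>-coordinate \<open>t\<close>. Integrating
  over the whole line makes the bound independent of the \<open>b\<close>-coordinate of
  \<open>x\<close>, as the Loomis-Whitney inequality demands.\<close>

lemma abs_powr_le_line_integral:
  assumes p: "p > 1" and b: "b \<in> Basis"
  shows "ennreal (\<bar>f x\<bar> powr p) \<le>
    (\<integral>\<^sup>+t. ennreal (p * \<bar>f (x + (t - x \<bullet> b) *\<^sub>R b)\<bar> powr (p - 1) * \<bar>G (x + (t - x \<bullet> b) *\<^sub>R b) \<bullet> b\<bar>) \<partial>lborel)"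
proof (cases "x \<bullet> b \<le> - (\<bar>R\<bar> + 1)")
  case True
  then have "norm x > R"
    using Basis_le_norm[OF b, of x] by linarith
  then show ?thesis by (simp add: f_outside)
next
  case False
  \<comment> \<open>A point whose \<open>b\<close>-coordinate is \<open>a\<close> has norm greater
    than \<open>R\<close>, so the boundary term at \<open>a\<close> vanishes.\<close>
  define a where "a = - (\<bar>R\<bar> + 1)"
  define y where "y = x - (x \<bullet> b) *\<^sub>R b"
  have y: "x + (t - x \<bullet> b) *\<^sub>R b = y + t *\<^sub>R b" for t
    by (simp add: y_def algebra_simps)
  let ?d = "\<lambda>t. p * (\<bar>f (y + t *\<^sub>R b)\<bar> powr (p - 1) * sgn (f (y + t *\<^sub>R b))) * (G (y + t *\<^sub>R b) \<bullet> b)"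
  have cd: "continuous_on UNIV ?d"
    using p
    by (intro continuous_intros continuous_on_compose2[OF continuous_signed_powr, of "p - 1"]
        continuous_on_compose2[OF cont_f] continuous_on_compose2[OF cont_G]) auto
  have ax: "a \<le> x \<bullet> b" using False by (simp add: a_def)
  have hb: "has_bochner_integral lborel (\<lambda>t. ?d t * indicator {a..x \<bullet> b} t)
      (\<bar>f (y + (x \<bullet> b) *\<^sub>R b)\<bar> powr p - \<bar>f (y + a *\<^sub>R b)\<bar> powr p)"
    by (rule has_bochner_integral_FTC_Icc_real[OF ax abs_powr_line_deriv[OF p]])
       (use cd in \<open>auto simp: continuous_on_eq_continuous_at\<close>)
  note has_bochner_integral_integral_eq[OF hb, symmetric]
  moreover have "f (y + a *\<^sub>R b) = 0"
  proof (rule f_outside)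
    have "(y + a *\<^sub>R b) \<bullet> b = a"
      using b by (simp add: y_def algebra_simps inner_diff_left)
    then show "R < norm (y + a *\<^sub>R b)"
      using Basis_le_norm[OF b, of "y + a *\<^sub>R b"] by (simp add: a_def)
  qed
  moreover have "y + (x \<bullet> b) *\<^sub>R b = x" by (simp add: y_def)
  ultimately have eq: "\<bar>f x\<bar> powr p = (LINT t|lborel. ?d t * indicator {a..x \<bullet> b} t)"
    by simp
  have "ennreal (\<bar>f x\<bar> powr p) = ennreal (norm (LINT t|lborel. ?d t * indicator {a..x \<bullet> b} t))"
    unfolding eq[symmetric] by simp
  also have "\<dots> \<le> (\<integral>\<^sup>+t. norm (?d t * indicator {a..x \<bullet> b} t) \<partial>lborel)"
    by (rule integral_norm_bound_ennreal) (use hb in \<open>simp add: has_bochner_integral_iff\<close>)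
  also have "\<dots> \<le> (\<integral>\<^sup>+t. ennreal (p * \<bar>f (y + t *\<^sub>R b)\<bar> powr (p - 1) * \<bar>G (y + t *\<^sub>R b) \<bullet> b\<bar>) \<partial>lborel)"
    using p by (intro nn_integral_mono ennreal_leI)
      (auto simp: abs_mult abs_sgn_eq indicator_def intro!: mult_nonneg_nonneg)
  finally show ?thesis by (simp add: y)
qed

end

section \<open>Gagliardo's product estimate on Euclidean space\<close>

lemma nn_integral_lborel_PiM:
  fixes F :: "'a::euclidean_space \<Rightarrow> ennreal"
  assumes "F \<in> borel_measurable borel"
  shows "(\<integral>\<^sup>+x. F x \<partial>lborel) = (\<integral>\<^sup>+w. F (\<Sum>c\<in>Basis. w c *\<^sub>R c) \<partial>PiM Basis (\<lambda>_. lborel))"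
  by (subst lborel_eq, subst nn_integral_distr) (use assms in auto)

lemma part_int_full:
  assumes "x \<in> space (PiM I (\<lambda>_. lborel))"
  shows "part_int I h x = (\<integral>\<^sup>+y. h y \<partial>PiM I (\<lambda>_. lborel))"
  unfolding part_int_def
proof (rule nn_integral_cong)
  fix y :: "'a \<Rightarrow> real" assume "y \<in> space (PiM I (\<lambda>_. lborel))"
  with assms have "override I y x = y"
    by (auto simp: override_def space_PiM PiE_iff extensional_def)
  then show "h (override I y x) = h y" by simp
qed

lemma part_int_singleton:
  assumes "b \<in> I" "h \<in> borel_measurable (PiM I (\<lambda>_. lborel))" "x \<in> space (PiM I (\<lambda>_. lborel))"
  shows "part_int {b} h x = (\<integral>\<^sup>+t. h (x(b := t)) \<partial>lborel)"
proof -
  have "override {} y z = z" for y z :: "'a \<Rightarrow> real" by (auto simp: override_def)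
  then have "part_int {} h z = h z" for z
    by (simp add: part_int_def PiM_empty nn_integral_count_space_finite)
  then show ?thesis
    using part_int_insert[of "{}" b I h x] assms by simp
qed

text \<open>With n the dimension, write \<open>u\<close> to the power n / (n - 1) as a product of n
  copies of \<open>u\<close> to the power 1 / (n - 1). The copy with index \<open>b\<close> is
  estimated by the integral of \<open>g b\<close> along direction \<open>b\<close>, and the
  Loomis-Whitney inequality bounds the integral of the product.\<close>

lemma Gagliardo_product:
  fixes u :: "'a::euclidean_space \<Rightarrow> real" and g :: "'a \<Rightarrow> 'a \<Rightarrow> real"
  assumes n: "DIM('a) \<ge> 2" and u0: "\<And>x. 0 \<le> u x" and u: "u \<in> borel_measurable borel"
    and g: "\<And>b. b \<in> Basis \<Longrightarrow> continuous_on UNIV (g b)"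
    and g0: "\<And>b x. 0 \<le> g b x" and g_out: "\<And>b x. norm x > R \<Longrightarrow> g b x = 0"
    and le: "\<And>b x. b \<in> Basis \<Longrightarrow> ennreal (u x) \<le> (\<integral>\<^sup>+t. ennreal (g b (x + (t - x \<bullet> b) *\<^sub>R b)) \<partial>lborel)"
  shows "(\<integral>\<^sup>+x. ennreal (u x powr (real DIM('a) / (real DIM('a) - 1))) \<partial>lborel)
    \<le> ennreal (\<Prod>b\<in>Basis. (LINT x|lborel. g b x) powr (1 / (real DIM('a) - 1)))"
proof -
  define z where "z w = (\<Sum>c\<in>Basis. w c *\<^sub>R c)" for w :: "'a \<Rightarrow> real"
  define h where "h b w = ennreal (g b (z w))" for b w
  define p where "p = 1 / (real DIM('a) - 1)"
  let ?P = "PiM (Basis :: 'a set) (\<lambda>_. lborel :: real measure)"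
  have [measurable]: "z \<in> ?P \<rightarrow>\<^sub>M borel"
    unfolding z_def by measurable
  have gm: "g b \<in> borel_measurable borel" if "b \<in> Basis" for b
    using g[OF that] by (rule borel_measurable_continuous_onI)
  have hm: "h b \<in> borel_measurable ?P" if "b \<in> Basis" for b
    unfolding h_def using gm[OF that] by measurable
  have z_inner: "z w \<bullet> b = w b" if "b \<in> Basis" for w b
    using that by (simp add: z_def inner_sum_left_Basis)
  have z_upd: "z (w(b := t)) = z w + (t - z w \<bullet> b) *\<^sub>R b" if "b \<in> Basis" for w b t
    by (rule euclidean_eqI) (use that in \<open>simp add: inner_add_left z_inner inner_Basis\<close>)
  \<comment> \<open>An arbitrary base point: once all coordinates are integrated out, the partial
    integral does not depend on it.\<close>
  define x0 where "x0 = restrict (\<lambda>_. 0 :: real) (Basis :: 'a set)"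
  have x0: "x0 \<in> space ?P" by (auto simp: x0_def space_PiM)
  have fin: "part_int A (h b) x < \<infinity>" if b: "b \<in> Basis" and A: "A \<subseteq> Basis" for b A x
  proof -
    obtain M where M: "M \<ge> 0" "\<And>x. \<bar>g b x\<bar> \<le> M"
      using continuous_bounded_support_bounded[OF g[OF b] g_out] by blast
    have finA: "finite A" using A finite_Basis finite_subset by blast
    \<comment> \<open>If an integrated coordinate leaves \<open>[-R, R]\<close>, the point has norm
      greater than \<open>R\<close> and \<open>g b\<close> vanishes there. The partial integral is
      therefore at most \<open>M\<close> times the volume of a cube.\<close>
    have "part_int A (h b) x \<le> (\<integral>\<^sup>+y. ennreal M * indicator (PiE A (\<lambda>_. {-R..R})) y \<partial>PiM A (\<lambda>_. lborel))"
      unfolding part_int_def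
    proof (rule nn_integral_mono)
      fix y :: "'a \<Rightarrow> real" assume y: "y \<in> space (PiM A (\<lambda>_. lborel))"
      show "h b (override A y x) \<le> ennreal M * indicator (PiE A (\<lambda>_. {-R..R})) y"
      proof (cases "y \<in> PiE A (\<lambda>_. {-R..R})")
        case True
        then show ?thesis using M(2)[of "z (override A y x)"] by (auto simp: h_def intro!: ennreal_leI)
      next
        case False
        then obtain c where c: "c \<in> A" "\<bar>y c\<bar> > R"
          using y by (force simp: PiE_iff space_PiM)
        then have "\<bar>z (override A y x) \<bullet> c\<bar> > R"
          using A by (subst z_inner) (auto simp: override_def)
        then have "norm (z (override A y x)) > R"
          using Basis_le_norm[of c "z (override A y x)"] c A by fastforce
        then show ?thesis by (simp add: h_def g_out)
      qed
    qed
    also have "\<dots> = ennreal M * (\<Prod>_\<in>A. emeasure lborel {-R..R})"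
      using finA
      by (subst nn_integral_cmult_indicator) (auto simp: lborel_PiM.emeasure_PiM intro!: sets_PiM_I_finite)
    also have "\<dots> < \<infinity>"
      by (auto simp: ennreal_mult_less_top infinity_ennreal_def emeasure_lborel_Icc_eq ennreal_power)
    finally show ?thesis .
  qed
  let ?L = "\<lambda>w. ennreal (\<Prod>b\<in>Basis. enn2real (part_int {b} (h b) w) powr p)"
  have "(\<integral>\<^sup>+x. ennreal (u x powr (real DIM('a) / (real DIM('a) - 1))) \<partial>lborel)
      = (\<integral>\<^sup>+w. ennreal (u (z w) powr (real DIM('a) / (real DIM('a) - 1))) \<partial>?P)"
    unfolding z_def using u by (intro nn_integral_lborel_PiM) measurable
  also have "\<dots> \<le> (\<integral>\<^sup>+w. ?L w \<partial>?P)"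
  proof (intro nn_integral_mono ennreal_leI)
    fix w assume w: "w \<in> space ?P"
    have *: "u (z w) \<le> enn2real (part_int {b} (h b) w)" if b: "b \<in> Basis" for b
    proof -
      have "ennreal (u (z w)) \<le> part_int {b} (h b) w"
        using le[OF b, of "z w"] by (simp add: part_int_singleton[OF b hm[OF b] w] h_def z_upd[OF b])
      then have "enn2real (ennreal (u (z w))) \<le> enn2real (part_int {b} (h b) w)"
        using fin[OF b, of "{b}" w] b by (intro enn2real_mono) auto
      then show ?thesis using u0 by simp
    qed
    have "u (z w) powr (real DIM('a) / (real DIM('a) - 1)) = (u (z w) powr p) powr real DIM('a)"
      by (simp add: powr_powr p_def)
    also have "\<dots> = (\<Prod>b\<in>(Basis::'a set). u (z w) powr p)"
      using DIM_positive[where 'a='a] by (cases "u (z w) = 0") (auto simp: powr_realpow power_0_left)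
    also have "\<dots> \<le> (\<Prod>b\<in>Basis. enn2real (part_int {b} (h b) w) powr p)"
      using n u0 by (intro prod_mono conjI powr_mono2 *) (auto simp: p_def)
    finally show "u (z w) powr (real DIM('a) / (real DIM('a) - 1))
      \<le> (\<Prod>b\<in>Basis. enn2real (part_int {b} (h b) w) powr p)" .
  qed
  also have "\<dots> = part_int Basis ?L x0"
    by (rule part_int_full[OF x0, symmetric])
  also have "\<dots> \<le> ennreal (\<Prod>b\<in>Basis. enn2real (part_int (insert b Basis) (h b) x0) powr p)"
    using n fin by (intro Loomis_Whitney x0 hm) (auto simp: p_def)
  also have "(\<Prod>b\<in>Basis. enn2real (part_int (insert b Basis) (h b) x0) powr p)
      = (\<Prod>b\<in>Basis. (LINT x|lborel. g b x) powr p)"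
  proof (intro prod.cong refl)
    fix b :: 'a assume b: "b \<in> Basis"
    have "part_int (insert b Basis) (h b) x0 = (\<integral>\<^sup>+w. ennreal (g b (z w)) \<partial>?P)"
      using b by (simp add: insert_absorb part_int_full[OF x0] h_def)
    also have "\<dots> = (\<integral>\<^sup>+x. ennreal (g b x) \<partial>lborel)"
      unfolding z_def using gm[OF b] by (intro nn_integral_lborel_PiM[symmetric]) measurable
    also have "\<dots> = ennreal (LINT x|lborel. g b x)"
      by (intro nn_integral_eq_integral integrable_continuous_bounded_support[OF g[OF b] g_out])
         (auto simp: g0)
    finally show "enn2real (part_int (insert b Basis) (h b) x0) powr p = (LINT x|lborel. g b x) powr p"
      by (simp add: Bochner_Integration.integral_nonneg g0)
  qed
  finally show ?thesis by (simp add: p_def)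
qed

section \<open>The Sobolev inequality\<close>

context C1_bounded_support
begin

lemma cont_powr_mult_G:
  assumes "a > 0"
  shows "continuous_on UNIV (\<lambda>x. \<bar>f x\<bar> powr a * norm (G x))"
  using assms by (intro continuous_intros continuous_on_abs_powr cont_f cont_G)

lemma integrable_abs_powr: "a > 0 \<Longrightarrow> integrable lborel (\<lambda>x. \<bar>f x\<bar> powr a)"
  by (rule integrable_continuous_bounded_support[OF continuous_on_abs_powr[OF _ cont_f], of _ R])
     (auto simp: f_outside)

lemma integrable_norm_G_powr: "a > 0 \<Longrightarrow> integrable lborel (\<lambda>x. norm (G x) powr a)"
  by (rule integrable_continuous_bounded_support[OF continuous_on_powr'[OF continuous_on_norm[OF cont_G]], of _ R])
     (auto simp: G_outside)

text \<open>This is the Sobolev inequality with exponent 1 for the function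
  \<open>\<bar>f\<bar> powr p\<close>, whose gradient has norm at most
  \<open>p * \<bar>f\<bar> powr (p - 1) * norm G\<close>. Each of the directional integrals is
  bounded by the integral of this expression.\<close>

lemma Sobolev_L1:
  fixes p :: real
  assumes n: "DIM('a) \<ge> 2" and p: "p > 1"
  shows "(LINT x|lborel. \<bar>f x\<bar> powr (p * real DIM('a) / (real DIM('a) - 1)))
    \<le> (p * (LINT x|lborel. \<bar>f x\<bar> powr (p - 1) * norm (G x))) powr (real DIM('a) / (real DIM('a) - 1))"
proof -
  let ?n = "real DIM('a)"
  define r where "r = 1 / (?n - 1)"
  let ?g = "\<lambda>b x. p * \<bar>f x\<bar> powr (p - 1) * \<bar>G x \<bullet> b\<bar>"
  let ?I = "p * (LINT x|lborel. \<bar>f x\<bar> powr (p - 1) * norm (G x))"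
  have I0: "?I \<ge> 0" using p by (auto intro!: mult_nonneg_nonneg Bochner_Integration.integral_nonneg)
  have cg: "continuous_on UNIV (?g b)" for b
    using p by (intro continuous_intros continuous_on_abs_powr cont_f cont_G) auto
  have g_le: "(LINT x|lborel. ?g b x) \<le> ?I" if b: "b \<in> Basis" for b
  proof -
    have "(LINT x|lborel. ?g b x) \<le> (LINT x|lborel. p * (\<bar>f x\<bar> powr (p - 1) * norm (G x)))"
    proof (rule integral_mono)
      show "integrable lborel (?g b)"
        by (rule integrable_continuous_bounded_support[OF cg, of R]) (simp add: G_outside)
      show "integrable lborel (\<lambda>x. p * (\<bar>f x\<bar> powr (p - 1) * norm (G x)))"
        using p by (intro integrable_mult_right
            integrable_continuous_bounded_support[OF cont_powr_mult_G, of _ R]) (auto simp: G_outside)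
      show "?g b x \<le> p * (\<bar>f x\<bar> powr (p - 1) * norm (G x))" for x
        using p Basis_le_norm[OF b, of "G x"] by (simp add: mult_left_mono mult.assoc)
    qed
    then show ?thesis by simp
  qed
  have "(\<integral>\<^sup>+x. ennreal ((\<bar>f x\<bar> powr p) powr (?n / (?n - 1))) \<partial>lborel)
      \<le> ennreal (\<Prod>b\<in>Basis. (LINT x|lborel. ?g b x) powr (1 / (?n - 1)))"
  proof (rule Gagliardo_product[OF n])
    show "(\<lambda>x. \<bar>f x\<bar> powr p) \<in> borel_measurable borel"
      using p by (intro borel_measurable_continuous_onI continuous_on_abs_powr cont_f) auto
    show "?g b x = 0" if "norm x > R" for b x using that by (simp add: G_outside)
    show "ennreal (\<bar>f x\<bar> powr p) \<le> (\<integral>\<^sup>+t. ennreal (?g b (x + (t - x \<bullet> b) *\<^sub>R b)) \<partial>lborel)"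
      if "b \<in> Basis" for b x by (rule abs_powr_le_line_integral[OF p that])
  qed (use p cg in auto)
  also have "\<dots> \<le> ennreal (\<Prod>b\<in>(Basis::'a set). ?I powr (1 / (?n - 1)))"
    using n p g_le
    by (intro ennreal_leI prod_mono conjI powr_mono2) (auto intro!: Bochner_Integration.integral_nonneg)
  also have "(\<Prod>b\<in>(Basis::'a set). ?I powr (1 / (?n - 1))) = ?I powr (?n / (?n - 1))"
    using I0 n by (cases "?I = 0") (auto simp: powr_realpow[symmetric] powr_powr power_0_left)
  finally have "(LINT x|lborel. (\<bar>f x\<bar> powr p) powr (?n / (?n - 1))) \<le> ?I powr (?n / (?n - 1))"
    by (intro integral_real_bounded) auto
  then show ?thesis using n by (simp add: powr_powr)
qed

text \<open>In the exponent 1 inequality for \<open>\<bar>f\<bar> powr p\<close>, Hoelder's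
  inequality bounds the right-hand side by a power of the integral \<open>S\<close> on the left.
  Since \<open>q\<close> is less than the dimension, that power is below 1, and it is
  absorbed.\<close>

lemma Sobolev:
  fixes q :: real
  assumes n: "DIM('a) \<ge> 2" and q: "1 < q" "q < DIM('a)"
  defines "Q \<equiv> q * real DIM('a) / (real DIM('a) - q)"
  shows "(LINT x|lborel. \<bar>f x\<bar> powr Q)
    \<le> (q * (real DIM('a) - 1) / (real DIM('a) - q) * (LINT x|lborel. norm (G x) powr q) powr (1 / q)) powr Q"
proof -
  let ?n = "real DIM('a)"
  \<comment> \<open>The exponent is chosen so that both the left-hand side and the Hoelder factor of
    \<open>\<bar>f\<bar> powr (p - 1)\<close> involve the same integral of
    \<open>\<bar>f\<bar> powr Q\<close>; these are \<open>e1\<close> and \<open>e2\<close>.\<close>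
  define p where "p = q * (?n - 1) / (?n - q)"
  have p: "p > 1" using n q by (simp add: p_def field_simps)
  have Q0: "Q > 0" using q by (simp add: Q_def)
  define S where "S = (LINT x|lborel. \<bar>f x\<bar> powr Q)"
  define B where "B = (LINT x|lborel. norm (G x) powr q)"
  have S0: "S \<ge> 0" unfolding S_def by (intro Bochner_Integration.integral_nonneg) auto
  have B0: "B \<ge> 0" unfolding B_def by (intro Bochner_Integration.integral_nonneg) auto
  have e1: "p * ?n / (?n - 1) = Q" using n q by (simp add: p_def Q_def)
  have e2: "Q * (1 - 1 / q) = p - 1" using n q by (simp add: p_def Q_def field_simps)
  have "(LINT x|lborel. \<bar>f x\<bar> powr (p - 1) * norm (G x))
      = (LINT x|lborel. (\<bar>f x\<bar> powr Q) powr (1 - 1 / q) * (norm (G x) powr q) powr (1 / q))"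
    using q by (simp add: powr_powr e2)
  also have "\<dots> \<le> S powr (1 - 1 / q) * B powr (1 / q)"
    unfolding S_def B_def using q Q0
    by (intro Holder2 integrable_abs_powr integrable_norm_G_powr) auto
  finally have H: "(LINT x|lborel. \<bar>f x\<bar> powr (p - 1) * norm (G x)) \<le> S powr (1 - 1 / q) * B powr (1 / q)" .
  have "S \<le> (p * (LINT x|lborel. \<bar>f x\<bar> powr (p - 1) * norm (G x))) powr (?n / (?n - 1))"
    using Sobolev_L1[OF n p] n by (simp add: S_def e1)
  also have "\<dots> \<le> (p * (S powr (1 - 1 / q) * B powr (1 / q))) powr (?n / (?n - 1))"
    using n p H by (intro powr_mono2 mult_left_mono)
      (auto intro!: mult_nonneg_nonneg Bochner_Integration.integral_nonneg)
  finally have le: "S \<le> (p * (S powr (1 - 1 / q) * B powr (1 / q))) powr (?n / (?n - 1))" .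
  have "S \<le> (p * B powr (1 / q)) powr Q"
  proof (cases "S = 0")
    case False
    with S0 have S: "S > 0" by simp
    have "S powr ((?n - 1) / ?n) \<le> ((p * (S powr (1 - 1 / q) * B powr (1 / q))) powr (?n / (?n - 1))) powr ((?n - 1) / ?n)"
      using n le S by (intro powr_mono2) auto
    also have "\<dots> = S powr (1 - 1 / q) * (p * B powr (1 / q))"
      using n p by (simp add: powr_powr)
    finally have "S powr ((?n - 1) / ?n) \<le> S powr (1 - 1 / q) * (p * B powr (1 / q))" .
    \<comment> \<open>The absorption: \<open>S\<close> is a positive real number, so its power can
      be divided out, and the difference of the exponents is \<open>1 / Q\<close>.\<close>
    then have "S powr ((?n - 1) / ?n) / S powr (1 - 1 / q) \<le> p * B powr (1 / q)"
      using S by (simp add: field_simps)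
    also have "S powr ((?n - 1) / ?n) / S powr (1 - 1 / q) = S powr (1 / Q)"
    proof -
      have "(?n - 1) / ?n - (1 - 1 / q) = 1 / Q"
        using n q by (simp add: Q_def field_simps)
      then show ?thesis by (simp add: powr_diff[symmetric])
    qed
    finally have "(S powr (1 / Q)) powr Q \<le> (p * B powr (1 / q)) powr Q"
      using Q0 by (intro powr_mono2) auto
    then show ?thesis using Q0 S by (simp add: powr_powr)
  qed simp
  then show ?thesis using n by (simp add: S_def B_def p_def)
qed

end

section \<open>Integration by parts and Hardy inequalities with regularised weight\<close>

text \<open>By translation invariance the difference quotients of \<open>h\<close> have integral zero.\<close>

lemma integral_directional_derivative_zero:
  fixes h D :: "'a::euclidean_space \<Rightarrow> real" and e :: 'a
  assumes deriv: "\<And>x t. ((\<lambda>t. h (x + t *\<^sub>R e)) has_real_derivative D (x + t *\<^sub>R e)) (at t)"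
    and ch: "continuous_on UNIV h" and cD: "continuous_on UNIV D"
    and h_out: "\<And>x. norm x > R \<Longrightarrow> h x = 0" and D_out: "\<And>x. norm x > R \<Longrightarrow> D x = 0"
  shows "(LINT x|lborel. D x) = 0"
proof -
  define d :: "nat \<Rightarrow> real" where "d m = 1 / real (Suc m)" for m
  have d: "0 < d m" "d m \<le> 1" for m by (auto simp: d_def)
  define u where "u m x = (h (x + d m *\<^sub>R e) - h x) / d m" for m x
  obtain M where M: "M \<ge> 0" "\<And>x. \<bar>D x\<bar> \<le> M"
    using continuous_bounded_support_bounded[OF cD D_out] by blast
  have ih: "integrable lborel h"
    by (rule integrable_continuous_bounded_support[OF ch h_out])
  have [measurable]: "h \<in> borel_measurable borel" and [measurable]: "D \<in> borel_measurable borel"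
    using ch cD by (auto intro: borel_measurable_continuous_onI)
  have shift: "integrable lborel (\<lambda>x. h (x + c)) \<and> (LINT x|lborel. h (x + c)) = (LINT x|lborel. h x)" for c
  proof -
    have "integrable (distr lborel borel ((+) c)) h" using ih by (simp add: lborel_distr_plus)
    then have "integrable lborel (\<lambda>x. h (c + x))"
      by (subst (asm) integrable_distr_eq) auto
    moreover have "(LINT x|lborel. h x) = (LINT x|distr lborel borel ((+) c). h x)"
      by (simp add: lborel_distr_plus)
    then have "(LINT x|lborel. h x) = (LINT x|lborel. h (c + x))"
      by (subst (asm) integral_distr) auto
    ultimately show ?thesis by (simp add: add.commute)
  qed
  have "(LINT x|lborel. u m x) = 0" for m
    using shift[of "d m *\<^sub>R e"] ih by (simp add: u_def)
  moreover have "(\<lambda>m. LINT x|lborel. u m x) \<longlonglongrightarrow> (LINT x|lborel. D x)"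
  proof (rule integral_dominated_convergence)
    \<comment> \<open>The mean value theorem bounds the difference quotients by \<open>M\<close>,
      and since \<open>d m \<le> 1\<close> they vanish outside the ball of radius
      \<open>R + norm e\<close>.\<close>
    show "integrable lborel (\<lambda>x. indicator (cball 0 (R + norm e)) x * M)"
      by (auto intro!: emeasure_compact_finite borel_compact integrable_mult_left)
    show "AE x in lborel. (\<lambda>m. u m x) \<longlonglongrightarrow> D x"
    proof (rule AE_I2)
      fix x
      have "((\<lambda>t. (h (x + t *\<^sub>R e) - h x) / t) \<longlongrightarrow> D x) (at 0)"
        using deriv[of x 0] by (simp add: DERIV_def)
      moreover have "filterlim d (at 0) sequentially"
        unfolding filterlim_at using d(1) LIMSEQ_inverse_real_of_nat
        by (auto simp: d_def[abs_def] inverse_eq_divide less_imp_neq[THEN not_sym])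
      ultimately show "(\<lambda>m. u m x) \<longlonglongrightarrow> D x"
        unfolding u_def by (rule filterlim_compose)
    qed
    fix m
    show "u m \<in> borel_measurable lborel" unfolding u_def by measurable
    show "AE x in lborel. norm (u m x) \<le> indicator (cball 0 (R + norm e)) x * M"
    proof (rule AE_I2)
      fix x
      show "norm (u m x) \<le> indicator (cball 0 (R + norm e)) x * M"
      proof (cases "norm x \<le> R + norm e")
        case True
        obtain t where "h (x + d m *\<^sub>R e) - h (x + 0 *\<^sub>R e) = (d m - 0) * D (x + t *\<^sub>R e)"
          using MVT2[OF d(1)[of m], of "\<lambda>t. h (x + t *\<^sub>R e)" "\<lambda>t. D (x + t *\<^sub>R e)"] deriv by blast
        then have "u m x = D (x + t *\<^sub>R e)" using d(1)[of m] by (simp add: u_def)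
        then show ?thesis using M True by simp
      next
        case False
        have "norm (d m *\<^sub>R e) \<le> norm e"
          using d[of m] by (simp add: mult_left_le_one_le)
        then have "norm (x + d m *\<^sub>R e) > R"
          using False norm_triangle_ineq4[of "x + d m *\<^sub>R e" "d m *\<^sub>R e"] by simp
        moreover have "norm x > R" using False norm_ge_zero[of e] by linarith
        ultimately show ?thesis using M by (simp add: u_def h_out)
      qed
    qed
  qed auto
  ultimately show ?thesis
    by (simp add: LIMSEQ_const_iff)
qed

text \<open>It replaces the square of the norm of x', hence \<open>reg K e x powr (a / 2)\<close>
  stands for the power \<open>a\<close> of that norm. For \<open>e > 0\<close> it is bounded below
  by \<open>e\<close>, so all its powers are continuous.\<close>

definition reg :: "'a::euclidean_space set \<Rightarrow> real \<Rightarrow> 'a \<Rightarrow> real" where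
  "reg K e x = e + (\<Sum>b\<in>K. (x \<bullet> b)\<^sup>2)"

lemma reg_pos: "e > 0 \<Longrightarrow> reg K e x > 0"
  unfolding reg_def by (intro add_pos_nonneg sum_nonneg) auto

lemma continuous_on_reg_powr:
  "e > 0 \<Longrightarrow> continuous_on UNIV (\<lambda>x. reg K e x powr a)"
  using reg_pos[of e K] by (auto intro!: continuous_intros simp: reg_def less_imp_neq[THEN not_sym])

lemma reg_line_deriv:
  assumes "b \<in> K" "K \<subseteq> Basis"
  shows "((\<lambda>t. reg K e (x + t *\<^sub>R b)) has_real_derivative 2 * ((x + t *\<^sub>R b) \<bullet> b)) (at t)"
proof -
  have K: "finite K" using assms(2) finite_Basis finite_subset by blast
  have "((\<lambda>t. reg K e (x + t *\<^sub>R b)) has_real_derivative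
      (\<Sum>c\<in>K. 2 * ((x + t *\<^sub>R b) \<bullet> c) * (b \<bullet> c))) (at t)"
    unfolding reg_def inner_add_left inner_scaleR_left
    by (auto intro!: derivative_eq_intros simp: power2_eq_square algebra_simps)
  also have "(\<Sum>c\<in>K. 2 * ((x + t *\<^sub>R b) \<bullet> c) * (b \<bullet> c)) = (\<Sum>c\<in>K. if c = b then 2 * ((x + t *\<^sub>R b) \<bullet> b) else 0)"
    using assms by (intro sum.cong) (auto simp: inner_Basis subset_eq)
  also have "\<dots> = 2 * ((x + t *\<^sub>R b) \<bullet> b)"
    using assms K by simp
  finally show ?thesis .
qed

context C1_bounded_support
begin

lemma integrable_weighted:
  assumes "p > 0" "e > 0"
  shows "integrable lborel (\<lambda>x. \<bar>f x\<bar> powr p * reg K e x powr a)"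
  using assms
  by (intro integrable_continuous_bounded_support[where R=R] continuous_on_mult
      continuous_on_abs_powr cont_f continuous_on_reg_powr) (auto simp: f_outside)

text \<open>Integrate \<open>\<bar>f\<bar> powr p\<close> against the divergence of the vector field \<open>x' (reg K e) powr (- s / 2)\<close>, where \<open>x'\<close> is
  the projection of \<open>x\<close> to the span of \<open>K\<close>; this divergence is at least \<open>(card K - s) (reg K e) powr (- s / 2)\<close>.\<close>

lemma Hardy_regularised:
  assumes K: "K \<subseteq> Basis" and p: "p > 1" and s: "0 \<le> s" and e: "e > 0"
  shows "(real (card K) - s) * (LINT x|lborel. \<bar>f x\<bar> powr p * reg K e x powr (- s / 2))
    \<le> p * (LINT x|lborel. \<bar>f x\<bar> powr (p - 1) * norm (G x) * reg K e x powr ((1 - s) / 2))"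
proof -
  let ?U = "reg K e"
  define sp where "sp x = \<bar>f x\<bar> powr (p - 1) * sgn (f x)" for x
  \<comment> \<open>\<open>D b\<close> is the derivative in direction \<open>b\<close> of the
    \<open>b\<close>-component of the field
    \<open>\<bar>f\<bar> powr p * reg K e powr (- s / 2)\<close> times x'. Each \<open>D b\<close>
    with \<open>b \<in> K\<close> integrates to 0.\<close>
  define D where "D b x = p * sp x * (G x \<bullet> b) * ((x \<bullet> b) * ?U x powr (- s / 2))
     + \<bar>f x\<bar> powr p * (?U x powr (- s / 2) - s * (x \<bullet> b)\<^sup>2 * ?U x powr (- s / 2 - 1))" for b x
  have csp: "continuous_on UNIV sp"
    unfolding sp_def using p
    by (intro continuous_on_compose2[OF continuous_signed_powr cont_f]) auto
  have cD: "continuous_on UNIV (D b)" for b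
    unfolding D_def using p e
    by (intro continuous_on_add continuous_on_diff continuous_on_mult continuous_on_inner continuous_on_power
        continuous_on_const continuous_on_id csp cont_G continuous_on_abs_powr cont_f continuous_on_reg_powr) auto
  have D_out: "D b x = 0" if "norm x > R" for b x
    using that by (simp add: D_def f_outside sp_def)
  have iD: "integrable lborel (D b)" for b
    by (rule integrable_continuous_bounded_support[OF cD D_out])
  have D0: "(LINT x|lborel. D b x) = 0" if b: "b \<in> K" for b
  proof (rule integral_directional_derivative_zero[where h = "\<lambda>x. \<bar>f x\<bar> powr p * ((x \<bullet> b) * ?U x powr (- s / 2))" and e = b and R = R])
    fix x t
    let ?y = "x + t *\<^sub>R b"
    have bb: "b \<bullet> b = 1" using b K by (auto simp: inner_Basis)
    have 1: "((\<lambda>t. ?U (x + t *\<^sub>R b) powr (- s / 2)) has_real_derivative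
        (- s / 2) * ?U ?y powr (- s / 2 - 1) * (2 * (?y \<bullet> b))) (at t)"
      by (rule DERIV_chain2[OF has_real_derivative_powr[OF reg_pos[OF e]] reg_line_deriv[OF b K]])
    have 2: "((\<lambda>t. (x + t *\<^sub>R b) \<bullet> b) has_real_derivative 1) (at t)"
      unfolding inner_add_left inner_scaleR_left
      by (auto intro!: derivative_eq_intros simp: bb)
    have "((\<lambda>t. \<bar>f (x + t *\<^sub>R b)\<bar> powr p * (((x + t *\<^sub>R b) \<bullet> b) * ?U (x + t *\<^sub>R b) powr (- s / 2)))
      has_real_derivative
        p * sp ?y * (G ?y \<bullet> b) * ((?y \<bullet> b) * ?U ?y powr (- s / 2)) +
        (1 * ?U ?y powr (- s / 2) + (- s / 2) * ?U ?y powr (- s / 2 - 1) * (2 * (?y \<bullet> b)) * (?y \<bullet> b))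
          * \<bar>f ?y\<bar> powr p) (at t)"
      unfolding sp_def by (intro DERIV_mult abs_powr_line_deriv p 1 2)
    moreover have "p * sp ?y * (G ?y \<bullet> b) * ((?y \<bullet> b) * ?U ?y powr (- s / 2)) +
        (1 * ?U ?y powr (- s / 2) + (- s / 2) * ?U ?y powr (- s / 2 - 1) * (2 * (?y \<bullet> b)) * (?y \<bullet> b))
          * \<bar>f ?y\<bar> powr p = D b ?y"
      by (simp add: D_def power2_eq_square algebra_simps)
    ultimately show "((\<lambda>t. \<bar>f (x + t *\<^sub>R b)\<bar> powr p * (((x + t *\<^sub>R b) \<bullet> b) * ?U (x + t *\<^sub>R b) powr (- s / 2)))
      has_real_derivative D b ?y) (at t)" by simp
  qed (use p e cD D_out in \<open>auto intro!: continuous_on_mult continuous_on_inner continuous_on_const continuous_on_id continuous_on_abs_powr cont_f continuous_on_reg_powr simp: f_outside\<close>)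
  let ?A = "\<lambda>x. \<bar>f x\<bar> powr p * ?U x powr (- s / 2)"
  let ?B = "\<lambda>x. \<bar>f x\<bar> powr (p - 1) * norm (G x) * ?U x powr ((1 - s) / 2)"
  have iA: "integrable lborel ?A" using p e by (intro integrable_weighted) auto
  have iB: "integrable lborel ?B"
    using p e by (intro integrable_continuous_bounded_support[where R=R] continuous_on_mult
      cont_powr_mult_G continuous_on_reg_powr) (auto simp: f_outside)
  \<comment> \<open>In the sum over \<open>K\<close>, the terms with \<open>G\<close> are bounded
    below by the Cauchy-Schwarz inequality. The remaining terms form the divergence of the weight
    field and use that the squared norm of x' is at most \<open>reg K e x\<close>.\<close>
  have le: "(real (card K) - s) * ?A x - p * ?B x \<le> (\<Sum>b\<in>K. D b x)" for x
  proof -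
    let ?r2 = "\<Sum>b\<in>K. (x \<bullet> b)\<^sup>2"
    have U: "?U x > 0" by (rule reg_pos[OF e])
    have r2: "?r2 \<le> ?U x" "0 \<le> ?r2" using e by (auto simp: reg_def intro: sum_nonneg)
    have cs: "\<bar>\<Sum>b\<in>K. (G x \<bullet> b) * (x \<bullet> b)\<bar> \<le> norm (G x) * ?U x powr (1 / 2)"
    proof -
      have "\<bar>\<Sum>b\<in>K. (G x \<bullet> b) * (x \<bullet> b)\<bar> \<le> (\<Sum>b\<in>K. \<bar>G x \<bullet> b\<bar> * \<bar>x \<bullet> b\<bar>)"
        by (rule order_trans[OF sum_abs]) (simp add: abs_mult)
      also have "\<dots> \<le> L2_set (\<lambda>b. G x \<bullet> b) K * L2_set (\<lambda>b. x \<bullet> b) K"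
        by (rule L2_set_mult_ineq)
      also have "\<dots> \<le> norm (G x) * ?U x powr (1 / 2)"
      proof (rule mult_mono)
        have "(\<Sum>b\<in>K. (G x \<bullet> b)\<^sup>2) \<le> (\<Sum>b\<in>Basis. (G x \<bullet> b)\<^sup>2)"
          using K by (intro sum_mono2) auto
        then show "L2_set (\<lambda>b. G x \<bullet> b) K \<le> norm (G x)"
          by (simp add: L2_set_def norm_eq_sqrt_inner euclidean_inner[of "G x" "G x"] power2_eq_square)
        show "L2_set (\<lambda>b. x \<bullet> b) K \<le> ?U x powr (1 / 2)"
          using r2 U by (simp add: L2_set_def powr_half_sqrt)
      qed (auto simp: L2_set_nonneg)
      finally show ?thesis .
    qed
    have hs: "?U x powr (1 / 2) * ?U x powr (- s / 2) = ?U x powr ((1 - s) / 2)"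
      by (simp add: powr_add[symmetric] field_simps)
    have "\<bar>sp x * (\<Sum>b\<in>K. (G x \<bullet> b) * (x \<bullet> b)) * ?U x powr (- s / 2)\<bar>
        = \<bar>sp x\<bar> * \<bar>\<Sum>b\<in>K. (G x \<bullet> b) * (x \<bullet> b)\<bar> * ?U x powr (- s / 2)"
      by (simp add: abs_mult)
    also have "\<dots> \<le> \<bar>f x\<bar> powr (p - 1) * (norm (G x) * ?U x powr (1 / 2)) * ?U x powr (- s / 2)"
      by (intro mult_right_mono mult_mono cs) (auto simp: sp_def abs_mult abs_sgn_eq)
    also have "\<dots> = ?B x" using hs by (simp add: mult.assoc)
    finally have 1: "- ?B x \<le> sp x * (\<Sum>b\<in>K. (G x \<bullet> b) * (x \<bullet> b)) * ?U x powr (- s / 2)"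
      by linarith
    have "?r2 * ?U x powr (- s / 2 - 1) \<le> ?U x * ?U x powr (- s / 2 - 1)"
      by (intro mult_right_mono r2) auto
    also have "\<dots> = ?U x powr (- s / 2)"
      using U by (simp add: powr_diff)
    finally have "s * (?r2 * ?U x powr (- s / 2 - 1)) \<le> s * ?U x powr (- s / 2)"
      using s by (intro mult_left_mono)
    then have 2: "\<bar>f x\<bar> powr p * ((real (card K) - s) * ?U x powr (- s / 2))
        \<le> \<bar>f x\<bar> powr p * (real (card K) * ?U x powr (- s / 2) - s * (?r2 * ?U x powr (- s / 2 - 1)))"
      by (intro mult_left_mono) (auto simp: algebra_simps)
    have "(\<Sum>b\<in>K. D b x) = p * (sp x * (\<Sum>b\<in>K. (G x \<bullet> b) * (x \<bullet> b)) * ?U x powr (- s / 2))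
        + \<bar>f x\<bar> powr p * (real (card K) * ?U x powr (- s / 2) - s * (?r2 * ?U x powr (- s / 2 - 1)))"
      by (simp add: D_def sum.distrib sum_subtractf sum_distrib_left sum_distrib_right right_diff_distrib mult_ac)
    moreover have "p * - ?B x \<le> p * (sp x * (\<Sum>b\<in>K. (G x \<bullet> b) * (x \<bullet> b)) * ?U x powr (- s / 2))"
      using p by (intro mult_left_mono 1) auto
    ultimately show ?thesis using 2 by (simp add: mult_ac)
  qed
  have "(real (card K) - s) * (LINT x|lborel. ?A x) - p * (LINT x|lborel. ?B x)
      = (LINT x|lborel. (real (card K) - s) * ?A x - p * ?B x)"
    using iA iB by simp
  also have "\<dots> \<le> (LINT x|lborel. (\<Sum>b\<in>K. D b x))"
    using iA iB iD le by (intro integral_mono) auto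
  also have "\<dots> = 0" using iD D0 by simp
  finally show ?thesis by simp
qed

text \<open>The exponent \<open>p\<close> is the one for which Hoelder's inequality with the three factors
  \<open>\<bar>f\<bar> powr p * reg K e powr (- s / 2)\<close>, \<open>\<bar>f\<bar> powr p0\<close> and \<open>norm G powr q\<close> bounds the right-hand side of the
  Hardy inequality by a power of its left-hand side, which is then absorbed.\<close>

lemma Hardy_interpolated_ge_1:
  assumes K: "K \<subseteq> Basis" and q: "1 < q" and s: "1 \<le> s" "s \<le> q" "s < real (card K)"
    and p0: "q \<le> p0" and e: "e > 0"
  defines "p \<equiv> (1 - s / q) * p0 + s"
  shows "(LINT x|lborel. \<bar>f x\<bar> powr p * reg K e x powr (- s / 2))
    \<le> (p / (real (card K) - s) * (LINT x|lborel. norm (G x) powr q) powr (1 / q)) powr s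
      * (LINT x|lborel. \<bar>f x\<bar> powr p0) powr (1 - s / q)"
proof -
  let ?U = "reg K e"
  define X where "X = (LINT x|lborel. \<bar>f x\<bar> powr p * ?U x powr (- s / 2))"
  define B where "B = (LINT x|lborel. norm (G x) powr q)"
  define S where "S = (LINT x|lborel. \<bar>f x\<bar> powr p0)"
  define c where "c = p / (real (card K) - s)"
  \<comment> \<open>This yields \<open>p \<ge> q > 1\<close>, so that the regularised Hardy
    inequality applies.\<close>
  have "p - q = (1 - s / q) * (p0 - q)" using q by (simp add: p_def field_simps)
  also have "\<dots> \<ge> 0" using q s p0 by (intro mult_nonneg_nonneg) auto
  finally have p: "p > 1" using q by simp
  have c0: "c > 0" using p s by (simp add: c_def)
  have X0: "X \<ge> 0" unfolding X_def by (intro Bochner_Integration.integral_nonneg) auto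
  \<comment> \<open>The three Hoelder exponents \<open>1 - 1 / s\<close>,
    \<open>1 / s - 1 / q\<close> and \<open>1 / q\<close> sum to 1 and are nonnegative because
    \<open>1 \<le> s \<le> q\<close>. The identities \<open>e1\<close> and \<open>e2\<close> match
    the powers of \<open>\<bar>f\<bar>\<close> and of the weight.\<close>
  have e1: "p * (1 - 1 / s) + p0 * (1 / s - 1 / q) = p - 1"
    using s q by (simp add: p_def field_simps)
  have e2: "- s / 2 * (1 - 1 / s) = (1 - s) / 2"
    using s by (simp add: field_simps)
  have pw: "\<bar>f x\<bar> powr (p - 1) * norm (G x) * ?U x powr ((1 - s) / 2)
     = (\<bar>f x\<bar> powr p * ?U x powr (- s / 2)) powr (1 - 1 / s) * (\<bar>f x\<bar> powr p0) powr (1 / s - 1 / q)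
       * (norm (G x) powr q) powr (1 / q)" for x
  proof -
    have "(\<bar>f x\<bar> powr p * ?U x powr (- s / 2)) powr (1 - 1 / s) * (\<bar>f x\<bar> powr p0) powr (1 / s - 1 / q)
        = \<bar>f x\<bar> powr (p * (1 - 1 / s)) * \<bar>f x\<bar> powr (p0 * (1 / s - 1 / q)) * ?U x powr (- s / 2 * (1 - 1 / s))"
      unfolding powr_mult powr_powr by (simp only: mult_ac)
    also have "\<dots> = \<bar>f x\<bar> powr (p - 1) * ?U x powr ((1 - s) / 2)"
      unfolding powr_add[symmetric] e1 e2 ..
    finally show ?thesis using q by (simp add: powr_powr mult_ac)
  qed
  have "(LINT x|lborel. \<bar>f x\<bar> powr (p - 1) * norm (G x) * ?U x powr ((1 - s) / 2))
      \<le> X powr (1 - 1 / s) * S powr (1 / s - 1 / q) * B powr (1 / q)"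
    unfolding pw X_def S_def B_def using p q s p0 e
    by (intro Holder3 integrable_weighted integrable_abs_powr integrable_norm_G_powr)
       (auto simp: field_simps)
  then have "(real (card K) - s) * X \<le> p * (X powr (1 - 1 / s) * S powr (1 / s - 1 / q) * B powr (1 / q))"
    using Hardy_regularised[OF K p _ e, of s] s p mult_left_mono[of _ _ p] unfolding X_def
    by (meson order_trans less_imp_le zero_less_one less_trans zero_le_one)
  then have le: "X \<le> X powr (1 - 1 / s) * (c * B powr (1 / q) * S powr (1 / s - 1 / q))"
    using s by (simp add: c_def field_simps)
  have "X \<le> (c * B powr (1 / q)) powr s * S powr (1 - s / q)"
  proof (cases "X = 0")
    case False
    with X0 have X: "X > 0" by simp
    \<comment> \<open>Cancelling the common power of \<open>X > 0\<close> leaves a bound for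
      \<open>X powr (1 / s)\<close>.\<close>
    have "X = X powr (1 - 1 / s) * X powr (1 / s)"
      using X by (simp add: powr_add[symmetric])
    with le have "X powr (1 - 1 / s) * X powr (1 / s)
        \<le> X powr (1 - 1 / s) * (c * B powr (1 / q) * S powr (1 / s - 1 / q))" by simp
    then have "X powr (1 / s) \<le> c * B powr (1 / q) * S powr (1 / s - 1 / q)"
      using X by (simp add: mult_le_cancel_left)
    then have "(X powr (1 / s)) powr s \<le> (c * B powr (1 / q) * S powr (1 / s - 1 / q)) powr s"
      using s by (intro powr_mono2) auto
    also have "(X powr (1 / s)) powr s = X" using X s by (simp add: powr_powr)
    also have "(c * B powr (1 / q) * S powr (1 / s - 1 / q)) powr s
        = (c * B powr (1 / q)) powr s * (S powr (1 / s - 1 / q)) powr s"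
      by (rule powr_mult)
    also have "(S powr (1 / s - 1 / q)) powr s = S powr (1 - s / q)"
    proof -
      have "(1 / s - 1 / q) * s = 1 - s / q" using s by (simp add: field_simps)
      then show ?thesis by (simp add: powr_powr)
    qed
    finally show ?thesis .
  qed simp
  then show ?thesis by (simp add: X_def S_def B_def c_def)
qed

text \<open>If \<open>s < 1\<close>, Hoelder's inequality interpolates between weight exponent 1,
  which is admissible as \<open>card K \<ge> 2\<close>, and the unweighted integral. In either case
  the Hardy inequality is applied with exponent \<open>max 1 s\<close>, and \<open>p0 + q\<close>
  bounds the numerator of its constant; this explains the condition on \<open>c\<close>.\<close>

lemma Hardy_interpolated:
  assumes K: "K \<subseteq> Basis" "card K \<ge> 2" and q: "1 < q" and s: "0 \<le> s" "s \<le> q" "s < real (card K)"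
    and p0: "q \<le> p0" and e: "e > 0" and c: "(p0 + q) / (real (card K) - max 1 s) \<le> c"
  defines "p \<equiv> (1 - s / q) * p0 + s"
  shows "(LINT x|lborel. \<bar>f x\<bar> powr p * reg K e x powr (- s / 2))
    \<le> (c * (LINT x|lborel. norm (G x) powr q) powr (1 / q)) powr s
      * (LINT x|lborel. \<bar>f x\<bar> powr p0) powr (1 - s / q)"
proof -
  let ?U = "reg K e"
  define B where "B = (LINT x|lborel. norm (G x) powr q)"
  define S where "S = (LINT x|lborel. \<bar>f x\<bar> powr p0)"
  have p_le: "0 \<le> (1 - t / q) * p0 + t" "(1 - t / q) * p0 + t \<le> p0 + q" if "0 \<le> t" "t \<le> q" for t
  proof -
    have "(1 - t / q) * p0 \<le> 1 * p0" using that q p0 by (intro mult_right_mono) auto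
    moreover have "0 \<le> (1 - t / q) * p0" using that q p0 by (intro mult_nonneg_nonneg) auto
    ultimately show "0 \<le> (1 - t / q) * p0 + t" "(1 - t / q) * p0 + t \<le> p0 + q" using that by auto
  qed
  have main: "(LINT x|lborel. \<bar>f x\<bar> powr ((1 - t / q) * p0 + t) * ?U x powr (- t / 2))
    \<le> (c * B powr (1 / q)) powr t * S powr (1 - t / q)"
    if t: "1 \<le> t" "t \<le> q" "t < real (card K)" "max 1 s = t" for t
  proof -
    have "((1 - t / q) * p0 + t) / (real (card K) - t) \<le> (p0 + q) / (real (card K) - t)"
      using p_le[of t] t by (intro divide_right_mono) auto
    also have "\<dots> \<le> c" using c t by simp
    finally have le: "((1 - t / q) * p0 + t) / (real (card K) - t) \<le> c" .
    have "0 \<le> ((1 - t / q) * p0 + t) / (real (card K) - t)"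
      using p_le[of t] t by (intro divide_nonneg_nonneg) auto
    have "(((1 - t / q) * p0 + t) / (real (card K) - t) * B powr (1 / q)) powr t * S powr (1 - t / q)
        \<le> (c * B powr (1 / q)) powr t * S powr (1 - t / q)"
      using t by (intro mult_right_mono powr_mono2 mult_nonneg_nonneg le \<open>0 \<le> _ / _\<close>) auto
    then show ?thesis
      using Hardy_interpolated_ge_1[OF K(1) q t(1-3) p0 e] unfolding B_def[symmetric] S_def[symmetric]
      by (rule order_trans[rotated])
  qed
  show ?thesis
  proof (cases "1 \<le> s")
    case True
    then show ?thesis using main[of s] s by (simp add: p_def B_def S_def)
  next
    case False
    define p1 where "p1 = (1 - 1 / q) * p0 + 1"
    define X1 where "X1 = (LINT x|lborel. \<bar>f x\<bar> powr p1 * ?U x powr (- 1 / 2))"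
    have X1: "X1 \<ge> 0" unfolding X1_def by (intro Bochner_Integration.integral_nonneg) auto
    have "X1 \<le> (c * B powr (1 / q)) powr 1 * S powr (1 - 1 / q)"
      unfolding X1_def p1_def using False K(2) q by (intro main) auto
    moreover have c0: "0 \<le> c"
      using False K(2) q p0 by (intro order_trans[OF _ c] divide_nonneg_nonneg) auto
    ultimately have X1_le: "X1 \<le> c * B powr (1 / q) * S powr (1 - 1 / q)" by simp
    have p1: "p1 > 0" using p_le[of 1] q p0 by (auto simp: p1_def intro!: add_nonneg_pos mult_nonneg_nonneg)
    \<comment> \<open>For fixed \<open>p0\<close> the exponent \<open>p\<close> is an affine
      function of \<open>s\<close>, with value \<open>p0\<close> at 0 and \<open>p1\<close> at 1.
      The power of \<open>f\<close> thus interpolates along with the weight.\<close>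
    have "p1 * s + p0 * (1 - s) = p" using q by (simp add: p1_def p_def field_simps)
    then have pw: "\<bar>f x\<bar> powr p * ?U x powr (- s / 2)
       = (\<bar>f x\<bar> powr p1 * ?U x powr (- 1 / 2)) powr s * (\<bar>f x\<bar> powr p0) powr (1 - s)" for x
      by (simp add: powr_mult powr_powr powr_add[symmetric])
    have "(LINT x|lborel. \<bar>f x\<bar> powr p * ?U x powr (- s / 2)) \<le> X1 powr s * S powr (1 - s)"
      unfolding pw X1_def S_def using False s p1 p0 q e
      by (intro Holder2 integrable_weighted integrable_abs_powr) auto
    also have "\<dots> \<le> (c * B powr (1 / q) * S powr (1 - 1 / q)) powr s * S powr (1 - s)"
      using X1 X1_le s by (intro mult_right_mono powr_mono2) auto
    also have "\<dots> = (c * B powr (1 / q)) powr s * (S powr ((1 - 1 / q) * s) * S powr (1 - s))"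
      using c0 by (simp add: powr_mult powr_powr)
    also have "S powr ((1 - 1 / q) * s) * S powr (1 - s) = S powr (1 - s / q)"
    proof -
      have "(1 - 1 / q) * s + (1 - s) = 1 - s / q" by (simp add: field_simps)
      then show ?thesis by (simp only: powr_add[symmetric])
    qed
    finally show ?thesis by (simp add: B_def S_def)
  qed
qed

section \<open>Removing the regularisation and the weighted inequality\<close>

text \<open>Fatou's lemma along \<open>e = 1 / (m + 1)\<close>. Working with nonnegative integrals,
  the uniform bound \<open>C\<close> gives both integrability and the estimate.\<close>

lemma weighted_integral_limit:
  assumes p: "p > 0" and C: "\<And>e. e > 0 \<Longrightarrow> (LINT x|lborel. \<bar>f x\<bar> powr p * reg K e x powr (- s / 2)) \<le> C"
  defines "r \<equiv> (\<lambda>x. sqrt (\<Sum>b\<in>K. (x \<bullet> b)\<^sup>2))"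
  shows "integrable lborel (\<lambda>x. \<bar>f x\<bar> powr p / r x powr s)"
    and "(LINT x|lborel. \<bar>f x\<bar> powr p / r x powr s) \<le> C"
proof -
  define d :: "nat \<Rightarrow> real" where "d m = 1 / real (Suc m)" for m
  have d: "0 < d m" for m by (auto simp: d_def)
  have d0: "d \<longlonglongrightarrow> 0" using LIMSEQ_inverse_real_of_nat by (simp add: d_def[abs_def] inverse_eq_divide)
  let ?u = "\<lambda>m x. ennreal (\<bar>f x\<bar> powr p * reg K (d m) x powr (- s / 2))"
  have [measurable]: "f \<in> borel_measurable borel"
    by (rule borel_measurable_continuous_onI[OF cont_f])
  have [measurable]: "reg K a \<in> borel_measurable borel" for a
    unfolding reg_def[abs_def] by measurable
  have [measurable]: "r \<in> borel_measurable borel"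
    unfolding r_def by measurable
  have C0: "C \<ge> 0"
    using C[of 1] by (intro order_trans[OF _ C[of 1]] Bochner_Integration.integral_nonneg) auto
  have "(\<integral>\<^sup>+x. ennreal (\<bar>f x\<bar> powr p / r x powr s) \<partial>lborel) \<le> (\<integral>\<^sup>+x. liminf (\<lambda>m. ?u m x) \<partial>lborel)"
  proof (rule nn_integral_mono)
    fix x
    show "ennreal (\<bar>f x\<bar> powr p / r x powr s) \<le> liminf (\<lambda>m. ?u m x)"
    \<comment> \<open>Where \<open>r x = 0\<close> the quotient is 0 by convention, also for
      \<open>s = 0\<close>, and there is nothing to show. Elsewhere the regularised integrands
      converge.\<close>
    proof (cases "r x = 0")
      case False
      let ?R = "\<Sum>b\<in>K. (x \<bullet> b)\<^sup>2"
      have R: "?R > 0" using False by (simp add: r_def less_le sum_nonneg)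
      have "(\<lambda>m. reg K (d m) x) \<longlonglongrightarrow> 0 + ?R"
        unfolding reg_def by (intro tendsto_intros d0)
      then have "(\<lambda>m. ?u m x) \<longlonglongrightarrow> ennreal (\<bar>f x\<bar> powr p * ?R powr (- s / 2))"
        using R by (intro tendsto_intros) auto
      then have "liminf (\<lambda>m. ?u m x) = ennreal (\<bar>f x\<bar> powr p * ?R powr (- s / 2))"
        by (intro lim_imp_Liminf) auto
      moreover have "?R powr (- s / 2) = 1 / r x powr s"
        using R by (simp add: r_def powr_half_sqrt[symmetric] powr_powr powr_minus_divide)
      ultimately show ?thesis by simp
    qed simp
  qed
  also have "\<dots> \<le> liminf (\<lambda>m. \<integral>\<^sup>+x. ?u m x \<partial>lborel)"
    by (rule nn_integral_liminf) measurable
  also have "\<dots> \<le> ennreal C"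
  proof (rule Liminf_le)
    have "(\<integral>\<^sup>+x. ?u m x \<partial>lborel) \<le> ennreal C" for m
      using C[OF d, of m] integrable_weighted[OF p d]
      by (subst nn_integral_eq_integral) (auto intro: ennreal_leI)
    then show "\<forall>\<^sub>F m in sequentially. (\<integral>\<^sup>+x. ?u m x \<partial>lborel) \<le> ennreal C" by simp
  qed simp
  finally have le: "(\<integral>\<^sup>+x. ennreal (\<bar>f x\<bar> powr p / r x powr s) \<partial>lborel) \<le> ennreal C" .
  then show "integrable lborel (\<lambda>x. \<bar>f x\<bar> powr p / r x powr s)"
    by (intro integrableI_bounded) (auto simp: less_top[symmetric] top_unique elim!: order.strict_trans1)
  show "(LINT x|lborel. \<bar>f x\<bar> powr p / r x powr s) \<le> C"
    using le C0 by (intro integral_real_bounded)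
qed

text \<open>The Hardy estimate is applied with the \<open>p0\<close> that corresponds to
  \<open>q'\<close>, and the integral of \<open>\<bar>f\<bar> powr p0\<close> is interpolated
  between the exponent \<open>q\<close> and the Sobolev exponent. The constant \<open>M\<close>
  dominates 1, the Sobolev constant and the Hardy constant for every admissible \<open>p0\<close>,
  so it does not depend on \<open>q'\<close>.\<close>

lemma weighted_Gagliardo_Nirenberg:
  fixes q s q' :: real
  defines "n \<equiv> real DIM('a)"
  assumes K: "K \<subseteq> Basis" "card K \<ge> 2" and q: "1 < q" "q < n"
    and s: "0 \<le> s" "s \<le> q" "s < real (card K)" and q': "q \<le> q'" "q' \<le> q * (n - s) / (n - q)"
  defines "r \<equiv> (\<lambda>x. sqrt (\<Sum>b\<in>K. (x \<bullet> b)\<^sup>2))"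
    and "M \<equiv> max 1 (max (q * (n - 1) / (n - q)) ((q * n / (n - q) + q) / (real (card K) - max 1 s)))"
  shows "integrable lborel (\<lambda>x. \<bar>f x\<bar> powr q' / r x powr s)"
    and "(LINT x|lborel. \<bar>f x\<bar> powr q' / r x powr s) powr (1 / q')
      \<le> M * ((LINT x|lborel. \<bar>f x\<bar> powr q) powr (1 / q)) powr ((n - s) / q' - n / q + 1)
          * ((LINT x|lborel. norm (G x) powr q) powr (1 / q)) powr (n / q - (n - s) / q')"
proof -
  have n2: "DIM('a) \<ge> 2" using card_mono[OF finite_Basis K(1)] K(2) by simp
  define Q where "Q = q * n / (n - q)"
  have qQ: "q < Q" using q by (simp add: Q_def field_simps)
  \<comment> \<open>Solves \<open>q' = (1 - s / q) * p0 + s\<close>. The range of \<open>q'\<close>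
    corresponds to \<open>q \<le> p0 \<le> Q\<close>. For \<open>s = q\<close> the relation no
    longer determines \<open>p0\<close>; then \<open>q' = q\<close>, and \<open>q\<close> is a valid
    choice.\<close>
  define p0 where "p0 = (if s = q then q else q * (q' - s) / (q - s))"
  have p0: "q \<le> p0" "p0 \<le> Q"
  proof -
    show "q \<le> p0" using q s q' by (auto simp: p0_def field_simps)
    show "p0 \<le> Q"
    proof (cases "s = q")
      case False
      have "q' - s \<le> q * (n - s) / (n - q) - s" using q' by simp
      also have "\<dots> = n * (q - s) / (n - q)" using q by (simp add: field_simps)
      finally have "q * (q' - s) / (q - s) \<le> q * (n * (q - s) / (n - q)) / (q - s)"
        using q s by (intro divide_right_mono mult_left_mono) auto
      also have "\<dots> = Q" using q s False by (simp add: Q_def)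
      finally show ?thesis using False by (simp add: p0_def)
    qed (use qQ in \<open>simp add: p0_def\<close>)
  qed
  have q'_eq: "q' = (1 - s / q) * p0 + s"
  proof (cases "s = q")
    case True
    then have "q' \<le> q" using q' q by simp
    then show ?thesis using True q' q by (simp add: p0_def)
  next
    case False
    then show ?thesis using q s by (simp add: p0_def field_simps)
  qed
  \<comment> \<open>The interpolation parameter with
    \<open>p0 = q * (1 - \<theta>) + Q * \<theta>\<close>.\<close>
  define \<theta> where "\<theta> = (p0 - q) / (Q - q)"
  have \<theta>: "0 \<le> \<theta>" "\<theta> \<le> 1" using p0 qQ by (auto simp: \<theta>_def)
  have "\<theta> * (Q - q) = p0 - q" using qQ by (simp add: \<theta>_def)
  then have p0_eq: "p0 = q * (1 - \<theta>) + Q * \<theta>" by (simp add: algebra_simps)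
  define A where "A = (LINT x|lborel. \<bar>f x\<bar> powr q) powr (1 / q)"
  define B where "B = (LINT x|lborel. norm (G x) powr q) powr (1 / q)"
  define S where "S = (LINT x|lborel. \<bar>f x\<bar> powr p0)"
  have M1: "M \<ge> 1" "q * (n - 1) / (n - q) \<le> M" by (auto simp: M_def)
  have M2: "(p0 + q) / (real (card K) - max 1 s) \<le> M"
  proof -
    have "(p0 + q) / (real (card K) - max 1 s) \<le> (Q + q) / (real (card K) - max 1 s)"
      using p0 K s by (intro divide_right_mono) auto
    also have "\<dots> \<le> M" by (simp add: M_def Q_def)
    finally show ?thesis .
  qed
  have A0: "A \<ge> 0" and B0: "B \<ge> 0" by (auto simp: A_def B_def)
  have Aq: "A powr q = (LINT x|lborel. \<bar>f x\<bar> powr q)"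
    using q by (simp add: A_def powr_powr Bochner_Integration.integral_nonneg)
  have SQ: "(LINT x|lborel. \<bar>f x\<bar> powr Q) \<le> (M * B) powr Q"
  proof -
    have "(LINT x|lborel. \<bar>f x\<bar> powr Q) \<le> (q * (n - 1) / (n - q) * B) powr Q"
      using Sobolev[OF n2, of q] q by (simp add: Q_def B_def n_def)
    also have "\<dots> \<le> (M * B) powr Q"
      using M1 B0 qQ q n2 by (intro powr_mono2 mult_right_mono mult_nonneg_nonneg divide_nonneg_nonneg) (auto simp: n_def)
    finally show ?thesis .
  qed
  have "(LINT x|lborel. \<bar>f x\<bar> powr p0)
      = (LINT x|lborel. (\<bar>f x\<bar> powr q) powr (1 - \<theta>) * (\<bar>f x\<bar> powr Q) powr \<theta>)"
    by (simp add: powr_powr powr_add[symmetric] p0_eq)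
  also have "\<dots> \<le> (LINT x|lborel. \<bar>f x\<bar> powr q) powr (1 - \<theta>) * (LINT x|lborel. \<bar>f x\<bar> powr Q) powr \<theta>"
    using \<theta> q qQ by (intro Holder2 integrable_abs_powr) auto
  also have "\<dots> \<le> (A powr q) powr (1 - \<theta>) * ((M * B) powr Q) powr \<theta>"
    unfolding Aq using \<theta> SQ
    by (intro mult_left_mono powr_mono2) (auto intro: Bochner_Integration.integral_nonneg)
  finally have S_le: "S \<le> A powr (q * (1 - \<theta>)) * (M * B) powr (Q * \<theta>)"
    by (simp add: S_def powr_powr)
  have bound: "(LINT x|lborel. \<bar>f x\<bar> powr q' * reg K e x powr (- s / 2))
      \<le> (M * B) powr s * S powr (1 - s / q)" if "e > 0" for e
    unfolding q'_eq B_def S_def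
    by (rule Hardy_interpolated[OF K q(1) s p0(1) that M2])
  have q'0: "q' > 0" using q q' by simp
  note lim = weighted_integral_limit[where K = K and s = s, OF q'0 bound]
  show "integrable lborel (\<lambda>x. \<bar>f x\<bar> powr q' / r x powr s)" unfolding r_def by (rule lim(1))
  define X where "X = (LINT x|lborel. \<bar>f x\<bar> powr q' / r x powr s)"
  have X0: "X \<ge> 0" unfolding X_def by (intro Bochner_Integration.integral_nonneg) auto
  let ?\<alpha> = "(n - s) / q' - n / q + 1" and ?\<beta> = "n / q - (n - s) / q'"
  have "X powr (1 / q') \<le> M * A powr ?\<alpha> * B powr ?\<beta>"
  proof -
    have sq: "0 \<le> 1 - s / q" using s q by simp
    have "X \<le> (M * B) powr s * S powr (1 - s / q)"
      unfolding X_def r_def by (rule lim(2))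
    also have "\<dots> \<le> (M * B) powr s * (A powr (q * (1 - \<theta>)) * (M * B) powr (Q * \<theta>)) powr (1 - s / q)"
      using S_le sq
      by (intro mult_left_mono powr_mono2) (auto simp: S_def intro!: Bochner_Integration.integral_nonneg)
    also have "\<dots> = A powr (q * (1 - \<theta>) * (1 - s / q)) * (M * B) powr (s + Q * \<theta> * (1 - s / q))"
      by (simp add: powr_mult powr_powr powr_add)
    also have "s + Q * \<theta> * (1 - s / q) = q' * ?\<beta>"
    proof -
      have "Q - q = q * q / (n - q)" using q by (simp add: Q_def field_simps)
      then have "Q * \<theta> = (p0 - q) * n / q" using q by (simp add: \<theta>_def Q_def field_simps)
      then have "s + Q * \<theta> * (1 - s / q) = s + (p0 * (1 - s / q) - q * (1 - s / q)) * n / q"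
        by (simp add: algebra_simps)
      also have "p0 * (1 - s / q) = q' - s" using q'_eq by (simp add: mult.commute)
      also have "q * (1 - s / q) = q - s" using q by (simp add: field_simps)
      also have "s + (q' - s - (q - s)) * n / q = q' * ?\<beta>" using q q'0 by (simp add: field_simps)
      finally show ?thesis .
    qed
    \<comment> \<open>Both pairs of exponents add up to the total degree \<open>q'\<close>, so the
      exponent of \<open>A\<close> follows from that of \<open>B\<close> by subtraction.\<close>
    also have "q * (1 - \<theta>) * (1 - s / q) = q' * ?\<alpha>"
    proof -
      have "q * (1 - \<theta>) * (1 - s / q) + (s + Q * \<theta> * (1 - s / q)) = q'"
        using q'_eq p0_eq by (simp add: algebra_simps)
      moreover have "q' * ?\<alpha> + q' * ?\<beta> = q'" by (simp add: algebra_simps)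
      ultimately show ?thesis using \<open>s + Q * \<theta> * (1 - s / q) = q' * ?\<beta>\<close> by linarith
    qed
    finally have "X powr (1 / q') \<le> (A powr (q' * ?\<alpha>) * (M * B) powr (q' * ?\<beta>)) powr (1 / q')"
      using q'0 X0 by (intro powr_mono2) auto
    also have "\<dots> = A powr ?\<alpha> * (M * B) powr ?\<beta>"
      using q'0 by (simp add: powr_mult powr_powr)
    also have "(M * B) powr ?\<beta> = M powr ?\<beta> * B powr ?\<beta>"
      using M1 B0 by (simp add: powr_mult)
    \<comment> \<open>As \<open>M \<ge> 1\<close>, its power is at most \<open>M\<close> once the
      exponent is at most 1, which is the upper bound on \<open>q'\<close> rearranged.\<close>
    also have "A powr ?\<alpha> * (M powr ?\<beta> * B powr ?\<beta>) \<le> A powr ?\<alpha> * (M powr 1 * B powr ?\<beta>)"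
    proof (intro mult_left_mono mult_right_mono powr_mono)
      have "q' * (n - q) \<le> q * (n - s)" using q' q by (simp add: pos_le_divide_eq)
      then show "?\<beta> \<le> 1" using q q'0 by (simp add: field_simps)
    qed (use M1 in auto)
    finally show ?thesis using M1 by (simp add: mult_ac)
  qed
  then show "(LINT x|lborel. \<bar>f x\<bar> powr q' / r x powr s) powr (1 / q')
      \<le> M * ((LINT x|lborel. \<bar>f x\<bar> powr q) powr (1 / q)) powr ?\<alpha>
          * ((LINT x|lborel. norm (G x) powr q) powr (1 / q)) powr ?\<beta>"
    by (simp add: X_def A_def B_def)
qed

end

section \<open>Smooth functions of compact support and coordinate splittings\<close>

text \<open>By linearity and the expansion in the standard basis, the Frechet derivative is the
  inner product with \<open>grad f\<close>. Outside a large ball \<open>f\<close> vanishes on an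
  open set, hence so does its gradient.\<close>

lemma C0_infinity_C1_bounded_support:
  fixes f :: "real ^ 'n \<Rightarrow> real"
  assumes "f \<in> C0_infinity"
  obtains R where "C1_bounded_support f (grad f) R"
proof -
  have Ck: "C_k (Suc 0) f" and comp: "compact (closure {x. f x \<noteq> 0})"
    using assms unfolding C0_infinity_def by blast+
  have diff: "f differentiable (at x)" for x using Ck by simp
  have cont: "continuous_on UNIV (\<lambda>x. frechet_derivative f (at x) (axis i 1))" for i using Ck by simp
  obtain R where R: "\<And>x. x \<in> closure {x. f x \<noteq> 0} \<Longrightarrow> norm x \<le> R"
    using compact_imp_bounded[OF comp] by (auto simp: bounded_iff)
  have f0: "f x = 0" if "norm x > R" for x
    using R[of x] that closure_subset[of "{x. f x \<noteq> 0}"] by force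
  have "C1_bounded_support f (grad f) R"
  proof
    fix x
    have D: "(f has_derivative frechet_derivative f (at x)) (at x)"
      using diff frechet_derivative_works by blast
    have "frechet_derivative f (at x) v = grad f x \<bullet> v" for v
    proof -
      have lin: "linear (frechet_derivative f (at x))"
        using D has_derivative_linear by blast
      have "frechet_derivative f (at x) v = frechet_derivative f (at x) (\<Sum>i\<in>UNIV. (v $ i) *\<^sub>R axis i 1)"
        using basis_expansion[of v] by (simp add: scalar_mult_eq_scaleR)
      also have "\<dots> = (\<Sum>i\<in>UNIV. (v $ i) * frechet_derivative f (at x) (axis i 1))"
        by (simp add: linear_sum[OF lin] linear_scale[OF lin])
      also have "\<dots> = grad f x \<bullet> v"
        by (simp add: grad_def inner_vec_def mult.commute)
      finally show ?thesis .
    qed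
    then have "frechet_derivative f (at x) = (\<lambda>v. grad f x \<bullet> v)" by blast
    with D show "(f has_derivative (\<lambda>v. grad f x \<bullet> v)) (at x)" by simp
  next
    show "continuous_on UNIV (grad f)"
      unfolding grad_def by (intro continuous_on_vec_lambda cont)
  next
    fix x :: "real ^ 'n" assume x: "norm x > R"
    show "f x = 0" by (rule f0[OF x])
    have "(f has_derivative (\<lambda>_. 0)) (at x)"
    proof (rule has_derivative_transform_within_open[OF has_derivative_const])
      show "open {y :: real ^ 'n. norm y > R}" by (intro open_Collect_less continuous_intros)
      show "x \<in> {y. norm y > R}" using x by simp
      show "0 = f y" if "y \<in> {y. norm y > R}" for y using f0 that by simp
    qed
    then have "frechet_derivative f (at x) = (\<lambda>_. 0)"
      by (rule frechet_derivative_at[symmetric])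
    then show "grad f x = 0" by (simp add: grad_def vec_eq_iff)
  qed
  then show ?thesis by (rule that)
qed

text \<open>The constant involves \<open>K\<close> only through its cardinality, so the quantifier
  over \<open>K\<close> can stand after the one over \<open>C\<close>.\<close>

lemma weighted_Gagliardo_Nirenberg_coordinates:
  fixes q s :: real
  assumes k: "2 \<le> k" and q: "1 < q" "q < real CARD('n)" and s: "0 \<le> s" "s \<le> q" "s < real k"
  shows "\<exists>C>0. \<forall>K::'n::finite set. card K = k \<longrightarrow>
        (\<forall>q' \<in> {q .. q * (CARD('n) - s) / (CARD('n) - q)}. \<forall>f \<in> C0_infinity.
          integrable lborel (\<lambda>x. \<bar>f x\<bar> powr q' / norm_on K x powr s) \<and>
          (LINT x|lborel. \<bar>f x\<bar> powr q' / norm_on K x powr s) powr (1 / q')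
            \<le> C * Lnorm q f powr ((CARD('n) - s) / q' - CARD('n) / q + 1)
                * Lnorm q (grad f) powr (CARD('n) / q - (CARD('n) - s) / q'))"
proof -
  let ?n = "real CARD('n)"
  let ?M = "max 1 (max (q * (?n - 1) / (?n - q)) ((q * ?n / (?n - q) + q) / (real k - max 1 s)))"
  show ?thesis
  proof (rule exI[of _ ?M], intro conjI allI impI ballI)
    fix K :: "'n set" and q' :: real and f :: "real ^ 'n \<Rightarrow> real"
    assume card: "card K = k" and q': "q' \<in> {q .. q * (?n - s) / (?n - q)}" and f: "f \<in> C0_infinity"
    obtain R where "C1_bounded_support f (grad f) R"
      using C0_infinity_C1_bounded_support[OF f] .
    then interpret C1_bounded_support f "grad f" R .
    \<comment> \<open>The index set becomes a set of standard basis vectors of the same cardinality,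
      for which the two descriptions of the norm of x' agree.\<close>
    let ?K = "(\<lambda>i. axis i 1 :: real ^ 'n) ` K"
    have inj: "inj_on (\<lambda>i. axis i 1 :: real ^ 'n) K" by (auto simp: inj_on_def axis_eq_axis)
    have cK: "card ?K = k" using card card_image[OF inj] by simp
    have KB: "?K \<subseteq> Basis" by (auto simp: Basis_vec_def)
    have no: "(\<lambda>x. sqrt (\<Sum>b\<in>?K. (x \<bullet> b)\<^sup>2)) = norm_on K"
      by (auto simp: norm_on_def sum.reindex[OF inj] inner_axis)
    show "integrable lborel (\<lambda>x. \<bar>f x\<bar> powr q' / norm_on K x powr s)"
      using weighted_Gagliardo_Nirenberg(1)[OF KB, of q s q'] k q s q' by (simp add: cK fun_cong[OF no, simplified])
    show "(LINT x|lborel. \<bar>f x\<bar> powr q' / norm_on K x powr s) powr (1 / q')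
            \<le> ?M * Lnorm q f powr ((?n - s) / q' - ?n / q + 1)
                * Lnorm q (grad f) powr (?n / q - (?n - s) / q')"
      using weighted_Gagliardo_Nirenberg(2)[OF KB, of q s q'] k q s q'
      by (simp add: cK fun_cong[OF no, simplified] Lnorm_def)
  qed simp
qed

theorem lemma2p4:
  "(\<forall>(N::nat) (k::nat) (q::real) (s::real).
      CARD('n::finite) = N \<longrightarrow> 2 \<le> k \<longrightarrow> k \<le> N \<longrightarrow>
      1 < q \<longrightarrow> q < N \<longrightarrow> 0 \<le> s \<longrightarrow> s \<le> q \<longrightarrow> s < k \<longrightarrow>
      (\<exists>C>0. \<forall>K::'n set. card K = k \<longrightarrow>
        (\<forall>q' \<in> {q .. q * (N - s) / (N - q)}. \<forall>f \<in> C0_infinity.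
          integrable lborel (\<lambda>x. \<bar>f x\<bar> powr q' / norm_on K x powr s) \<and>
          (LINT x|lborel. \<bar>f x\<bar> powr q' / norm_on K x powr s) powr (1 / q')
            \<le> C * Lnorm q f powr ((N - s) / q' - N / q + 1)
                * Lnorm q (grad f) powr (N / q - (N - s) / q'))))
   \<and>
   (\<forall>s::real. 0 \<le> s \<longrightarrow> s < 2 \<longrightarrow>
      (\<exists>C>0. \<forall>q' \<in> {2 .. 2 * (3 - s)}. \<forall>f \<in> (C0_infinity :: (real ^ 3 \<Rightarrow> real) set).
        let r = (\<lambda>x::real ^ 3. sqrt ((x $ 1)\<^sup>2 + (x $ 2)\<^sup>2)) in
          integrable lborel (\<lambda>x. \<bar>f x / r x powr (s / q')\<bar> powr q') \<and>
          Lnorm q' (\<lambda>x. f x / r x powr (s / q'))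
            \<le> C * Lnorm 2 f powr ((3 - s) / q' - 1 / 2)
                * Lnorm 2 (grad f) powr (3 / 2 - (3 - s) / q')))"
  (is "?general \<and> ?special")
proof
  show ?general
    using weighted_Gagliardo_Nirenberg_coordinates[where 'n = 'n] by blast
next
  show ?special
  proof (intro allI impI)
    fix s :: real assume s: "0 \<le> s" "s < 2"
    let ?K = "{1, 2} :: 3 set"
    have K: "card ?K = 2" by simp
    obtain C where "C > 0" and
      C: "\<And>q' f. q' \<in> {2 .. 2 * (3 - s)} \<Longrightarrow> f \<in> (C0_infinity :: (real ^ 3 \<Rightarrow> real) set) \<Longrightarrow>
          integrable lborel (\<lambda>x. \<bar>f x\<bar> powr q' / norm_on ?K x powr s) \<and>
          (LINT x|lborel. \<bar>f x\<bar> powr q' / norm_on ?K x powr s) powr (1 / q')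
            \<le> C * Lnorm 2 f powr ((3 - s) / q' - 1 / 2)
                * Lnorm 2 (grad f) powr (3 / 2 - (3 - s) / q')"
      using weighted_Gagliardo_Nirenberg_coordinates[where 'n = 3, of 2 2 s] s K
      by (auto simp: algebra_simps)
    show "\<exists>C>0. \<forall>q' \<in> {2 .. 2 * (3 - s)}. \<forall>f \<in> (C0_infinity :: (real ^ 3 \<Rightarrow> real) set).
        let r = (\<lambda>x::real ^ 3. sqrt ((x $ 1)\<^sup>2 + (x $ 2)\<^sup>2)) in
          integrable lborel (\<lambda>x. \<bar>f x / r x powr (s / q')\<bar> powr q') \<and>
          Lnorm q' (\<lambda>x. f x / r x powr (s / q'))
            \<le> C * Lnorm 2 f powr ((3 - s) / q' - 1 / 2)
                * Lnorm 2 (grad f) powr (3 / 2 - (3 - s) / q')"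
    proof (intro exI[of _ C] conjI ballI \<open>C > 0\<close>)
      fix q' :: real and f :: "real ^ 3 \<Rightarrow> real"
      assume q': "q' \<in> {2 .. 2 * (3 - s)}" and f: "f \<in> C0_infinity"
      \<comment> \<open>Raising the denominator \<open>r x powr (s / q')\<close> to the power
        \<open>q'\<close> gives \<open>r x powr s\<close>, which turns the norm of the quotient into
        the weighted integral.\<close>
      have "\<bar>f x / sqrt ((x $ 1)\<^sup>2 + (x $ 2)\<^sup>2) powr (s / q')\<bar> powr q' = \<bar>f x\<bar> powr q' / norm_on ?K x powr s" for x
        using q' by (simp add: norm_on_def abs_divide powr_divide powr_powr)
      then show "let r = (\<lambda>x::real ^ 3. sqrt ((x $ 1)\<^sup>2 + (x $ 2)\<^sup>2)) in
          integrable lborel (\<lambda>x. \<bar>f x / r x powr (s / q')\<bar> powr q') \<and>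
          Lnorm q' (\<lambda>x. f x / r x powr (s / q'))
            \<le> C * Lnorm 2 f powr ((3 - s) / q' - 1 / 2)
                * Lnorm 2 (grad f) powr (3 / 2 - (3 - s) / q')"
        using C[OF q' f] by (simp add: Lnorm_def)
    qed
  qed
qed

end
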